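(* Let $Y$ be a real-valued Lévy process drifting to $+\infty$ that has positive jumps, with Lévy measure $\pi$, let $\overline{\pi}(x):=\pi([x,+\infty[)$ for $x>0$, and let $I(Y):=\int_0^{+\infty}e^{-Y(t)}\,dt$. (1) There is a positive constant $C$ such that for all $x>0$ small enough, $\mathbb{P}\left(I(Y)\leq x\right)\geq C\,x\,\overline{\pi}(\log(1/x))$. (2) Let $S\in]0,+\infty]$ be the supremum of the support of $\pi(\cdot\cap]0,+\infty[)$ ($S=+\infty$ if this support is not bounded from above). For any $c>\frac{1}{2S}$ (with the convention $\frac{1}{2\infty}=0$), for all $x>0$ small enough, $\mathbb{P}\left(I(Y)\leq x\right)\geq e^{-c(\log(x))^2}$. (3) In particular, if $Y=\alpha N$ where $N$ is a standard Poisson process and $\alpha>0$, then $$-\log\left(\mathbb{P}\left(I(\alpha N)\leq x\right)\right)\underset{x\to0}{\sim}\frac{1}{2\alpha}\left(\log(x)\right)^2 .$$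
   Context: $Y$ drifts to $+\infty$ means $Y(t)\to+\infty$ a.s.; $Y(0)=0$ and paths are càdlàg. "Has positive jumps" means that $\pi(\cdot\cap]0,+\infty[)$ is non-zero. $Y$ is not assumed to be spectrally one-sided. A standard Poisson process here is a Poisson counting process with unit jumps and arbitrary intensity parameter $p>0$ (the equivalent in (3) does not depend on $p$). The notation $f\sim g$ means that $f/g\to1$. *)

theory Defs
  imports "HOL-Probability.Probability" "HOL-Library.Landau_Symbols"
begin

definition cadlag :: "(real \<Rightarrow> real) \<Rightarrow> bool" where
  "cadlag f \<longleftrightarrow>
     (\<forall>t\<ge>0. (f \<longlongrightarrow> f t) (at_right t)) \<and> (\<forall>t>0. \<exists>l. (f \<longlongrightarrow> l) (at_left t))"

definition jump :: "(real \<Rightarrow> real) \<Rightarrow> real \<Rightarrow> real" where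
  "jump f t = f t - Lim (at_left t) f"

text \<open>The time set is the half-line of nonnegative reals; the values of \<open>Y t\<close> for negative
  \<open>t\<close> are never constrained or used.\<close>

locale levy_process = prob_space M
  for M :: "'a measure" and Y :: "real \<Rightarrow> 'a \<Rightarrow> real" +
  assumes rv: "t \<ge> 0 \<Longrightarrow> Y t \<in> borel_measurable M"
    and start: "\<omega> \<in> space M \<Longrightarrow> Y 0 \<omega> = 0"
    and paths: "\<omega> \<in> space M \<Longrightarrow> cadlag (\<lambda>t. Y t \<omega>)"
    and indep_increments:
      "\<And>(n::nat) (t :: nat \<Rightarrow> real). 0 \<le> t 0 \<Longrightarrow> mono t \<Longrightarrow>
         indep_vars (\<lambda>_. borel) (\<lambda>i \<omega>. Y (t (Suc i)) \<omega> - Y (t i) \<omega>) {..<n}"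
    and stationary_increments:
      "\<And>s t. 0 \<le> s \<Longrightarrow> 0 \<le> t \<Longrightarrow>
         distr M borel (\<lambda>\<omega>. Y (s + t) \<omega> - Y s \<omega>) = distr M borel (Y t)"

text \<open>The L\'evy measure assigns to a Borel set the expected number of jumps of the process,
  per unit of time, whose size is nonzero and lies in that set.\<close>

definition is_levy_measure :: "'a measure \<Rightarrow> (real \<Rightarrow> 'a \<Rightarrow> real) \<Rightarrow> real measure \<Rightarrow> bool" where
  "is_levy_measure M Y \<pi> \<longleftrightarrow> sets \<pi> = sets borel \<and>
     (\<forall>A\<in>sets borel. emeasure \<pi> A =
        (\<integral>\<^sup>+ \<omega>. emeasure (count_space UNIV)
                  {t \<in> {0<..1}. jump (\<lambda>s. Y s \<omega>) t \<in> A - {0}} \<partial>M))"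

definition drifts_to_infinity :: "'a measure \<Rightarrow> (real \<Rightarrow> 'a \<Rightarrow> real) \<Rightarrow> bool" where
  "drifts_to_infinity M Y \<longleftrightarrow> (AE \<omega> in M. filterlim (\<lambda>t. Y t \<omega>) at_top at_top)"

definition has_positive_jumps :: "real measure \<Rightarrow> bool" where
  "has_positive_jumps \<pi> \<longleftrightarrow> emeasure \<pi> {0<..} \<noteq> 0"

definition levy_tail :: "real measure \<Rightarrow> real \<Rightarrow> ennreal" where
  "levy_tail \<pi> x = emeasure \<pi> {x..}"

definition measure_support :: "real measure \<Rightarrow> real set" where
  "measure_support \<mu> = {x. \<forall>U. open U \<and> x \<in> U \<longrightarrow> emeasure \<mu> U > 0}"

text \<open>The density below is the measure \<open>A \<mapsto> \<pi> (A \<inter> {0<..})\<close>.\<close>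

definition sup_positive_jumps :: "real measure \<Rightarrow> ereal" where
  "sup_positive_jumps \<pi> = Sup (ereal ` measure_support (density \<pi> (indicator {0<..})))"

definition exp_functional :: "(real \<Rightarrow> 'a \<Rightarrow> real) \<Rightarrow> 'a \<Rightarrow> ennreal" where
  "exp_functional Y \<omega> = (\<integral>\<^sup>+ t\<in>{0..}. ennreal (exp (- Y t \<omega>)) \<partial>lborel)"

definition cdf_exp_functional :: "'a measure \<Rightarrow> (real \<Rightarrow> 'a \<Rightarrow> real) \<Rightarrow> real \<Rightarrow> real" where
  "cdf_exp_functional M Y x = measure M {\<omega> \<in> space M. exp_functional Y \<omega> \<le> ennreal x}"

text \<open>With the L\'evy process axioms, Poisson marginals force the paths to be, almost surely,
  counting paths with unit jumps.\<close>

locale poisson_process = levy_process M N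
  for M :: "'a measure" and N :: "real \<Rightarrow> 'a \<Rightarrow> real" and p :: real +
  assumes intensity_pos: "p > 0"
    and poisson_marginals:
      "t > 0 \<Longrightarrow> distr M borel (N t) = distr (measure_pmf (poisson_pmf (p * t))) borel real"

end

theory Submission
  imports Defs "HOL-Real_Asymp.Real_Asymp"
begin

text \<open>Splitting at a fixed time \<open>s\<close> gives \<open>I = \<integral>\<^sub>0\<^sup>s e\<^bsup>-Y(t)\<^esup> dt + e\<^bsup>-Y(s)\<^esup> I'\<close> with \<open>I'\<close> an independent copy
  of \<open>I\<close>. If \<open>Y\<close> makes one large jump before time \<open>s\<close> without ever going far down, then \<open>I\<close> is small.
  The probability of such a large jump is at least a constant times \<open>s\<close> times the tail of the L\'evy
  measure; this is obtained without the L\'evy--It\^o decomposition, by counting large increments over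
  fine grids and Fatou's lemma. Taking \<open>s\<close> proportional to \<open>x\<close> and a jump of size about \<open>ln (1 / x)\<close>
  gives (1). Iterating with jumps of size about \<open>S\<close> gives (2); the start of the iteration needs that
  \<open>I\<close> is finite, which follows from transience. In the Poisson case, \<open>I \<le> x\<close> forces at least \<open>j\<close> jumps
  before time \<open>x e\<^bsup>\<alpha> j\<^esup>\<close> for every \<open>j\<close>, and a weighted exponential moment of the increments bounds the
  probability of this from above.\<close>

section \<open>The Markov property\<close>

text \<open>The axioms control only finitely many increments at a time, whereas the events of
  interest concern whole paths. The Markov property is therefore proved as independence of random
  elements of product spaces, and every path event or functional is encoded through countably many
  coordinates, with right-continuity as the link. Since negative jumps and infinitely many small
  jumps are allowed, the size of the path around a large jump has to be controlled separately. The
  substitute is that the path stays within \<tau> of 0 on a short time interval with probability at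
  least 1/2. The length of that interval depends on \<tau> and not on the size of the jump; this
  lets the jump size grow like \<open>ln (1 / x)\<close> while the time shrinks like x in (1). The
  constant 1/(2 \<alpha>) in (3) comes from a product of times: with n about
  \<open>ln (1 / x) / \<alpha>\<close>, both bounds are to leading order the product of x
  exp(\<alpha> j) over j up to n, which is exp(-(ln x)^2 / (2 \<alpha>)) to leading order in the
  exponent.\<close>

lemma finite_times_grid:
  fixes F :: "real set"
  assumes "finite F" "F \<subseteq> {0..}"
  obtains t :: "nat \<Rightarrow> real" and n where "mono t" "t 0 = 0" "0 < n" "F \<subseteq> t ` {..<n}"
proof -
  define xs where "xs = sorted_list_of_set (insert 0 F)"
  have xs: "set xs = insert 0 F" "sorted xs" "xs \<noteq> []"
    using assms(1) by (simp_all only: xs_def set_sorted_list_of_set finite_insert sorted_sorted_list_of_set sorted_list_of_set_eq_Nil_iff insert_not_empty not_False_eq_True)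
  \<comment> \<open>Beyond the list the sequence rests at the last point, which keeps it monotone on
    all indices, as \<open>indep_increments\<close> demands.\<close>
  define t where "t i = (if i < length xs then xs ! i else last xs)" for i
  have le: "t i \<le> t j" if "i \<le> j" for i j
    using that xs(2,3) by (auto simp: t_def last_conv_nth sorted_iff_nth_mono)
  have in_t: "x \<in> t ` {..<length xs}" if "x \<in> insert 0 F" for x
    using that xs(1) by (auto simp: t_def in_set_conv_nth image_iff Bex_def)
      (metis in_set_conv_nth insertCI)+
  obtain i where "t i = 0" using in_t[of 0] by auto
  moreover have "t 0 \<in> insert 0 F" using xs by (auto simp: t_def simp flip: xs(1))
  then have "t 0 \<ge> 0" using assms(2) by auto
  ultimately have "t 0 = 0" using le[of 0 i] by simp
  moreover have "0 < length xs" using xs(3) by simp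
  moreover have "mono t" using le by (intro monoI)
  ultimately show ?thesis using in_t that by blast
qed

lemma mono_nonneg: "mono (t::nat \<Rightarrow> real) \<Longrightarrow> 0 \<le> t 0 \<Longrightarrow> 0 \<le> t i"
  by (meson monoD le0 order_trans)

abbreviation path_space :: "(real \<Rightarrow> real) measure" where
  "path_space \<equiv> \<Pi>\<^sub>M t\<in>{0..}. borel"

context levy_process
begin

text \<open>Restriction to the time set makes \<open>past s\<close> and \<open>shift s\<close>
  elements of product spaces. The end point s belongs to the past, and \<open>shift 0\<close> is the
  whole path because paths start at 0.\<close>

definition past :: "real \<Rightarrow> 'a \<Rightarrow> real \<Rightarrow> real" where
  "past s \<omega> = (\<lambda>t\<in>{0..s}. Y t \<omega>)"

definition shift :: "real \<Rightarrow> 'a \<Rightarrow> real \<Rightarrow> real" where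
  "shift s \<omega> = (\<lambda>t\<in>{0..}. Y (s + t) \<omega> - Y s \<omega>)"

lemma measurable_past [measurable]: "past s \<in> measurable M (\<Pi>\<^sub>M t\<in>{0..s}. borel)"
  unfolding past_def by (intro measurable_restrict) (auto intro: rv)

lemma measurable_shift [measurable]: "0 \<le> s \<Longrightarrow> shift s \<in> measurable M path_space"
  unfolding shift_def by (intro measurable_restrict borel_measurable_diff rv) auto

definition increments :: "(nat \<Rightarrow> real) \<Rightarrow> nat set \<Rightarrow> 'a \<Rightarrow> nat \<Rightarrow> real" where
  "increments t K \<omega> = (\<lambda>i\<in>K. Y (t (Suc i)) \<omega> - Y (t i) \<omega>)"

lemma measurable_increments [measurable]:
  "mono t \<Longrightarrow> 0 \<le> t 0 \<Longrightarrow> increments t K \<in> measurable M (\<Pi>\<^sub>M i\<in>K. borel)"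
  unfolding increments_def
  by (intro measurable_restrict borel_measurable_diff rv) (auto intro: mono_nonneg)

text \<open>The right-hand side sees the grid only through its steps, so translating the grid leaves
  the law unchanged. This is the source of the stationarity of \<open>shift\<close>.\<close>

lemma distr_increments:
  assumes t: "mono t" "0 \<le> t 0" and n: "0 < n"
  shows "distr M (\<Pi>\<^sub>M i\<in>{..<n}. borel) (increments t {..<n}) =
    (\<Pi>\<^sub>M i\<in>{..<n}. distr M borel (Y (t (Suc i) - t i)))"
proof -
  have m: "Y (t (Suc i)) \<in> borel_measurable M" "Y (t i) \<in> borel_measurable M" for i
    using t by (auto intro!: rv mono_nonneg)
  have "distr M (\<Pi>\<^sub>M i\<in>{..<n}. borel) (increments t {..<n}) =
    (\<Pi>\<^sub>M i\<in>{..<n}. distr M borel (\<lambda>\<omega>. Y (t (Suc i)) \<omega> - Y (t i) \<omega>))"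
    unfolding increments_def
    using indep_increments[OF t(2,1), of n] n m
    by (subst (asm) indep_vars_iff_distr_eq_PiM') auto
  also have "\<dots> = (\<Pi>\<^sub>M i\<in>{..<n}. distr M borel (Y (t (Suc i) - t i)))"
  proof (intro PiM_cong refl)
    fix i
    show "distr M borel (\<lambda>\<omega>. Y (t (Suc i)) \<omega> - Y (t i) \<omega>) = distr M borel (Y (t (Suc i) - t i))"
      using stationary_increments[of "t i" "t (Suc i) - t i"] mono_nonneg[OF t, of i] monoD[OF t(1), of i "Suc i"]
      by simp
  qed
  finally show ?thesis .
qed

lemma indep_var_increments:
  assumes t: "mono t" "0 \<le> t 0"
  shows "indep_var (\<Pi>\<^sub>M i\<in>{..<m}. borel) (increments t {..<m})
    (\<Pi>\<^sub>M i\<in>{m..<n}. borel) (increments t {m..<n})"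
  unfolding increments_def
  using indep_increments[OF t(2,1), of "max m n"]
  by (intro indep_var_restrict[where I="{..<max m n}"]) auto

lemma sum_increments:
  assumes "{m..<k} \<subseteq> K" "m \<le> k"
  shows "(\<Sum>i=m..<k. increments t K \<omega> i) = Y (t k) \<omega> - Y (t m) \<omega>"
proof -
  have "(\<Sum>i=m..<k. increments t K \<omega> i) = (\<Sum>i=m..<k. Y (t (Suc i)) \<omega> - Y (t i) \<omega>)"
    using assms by (intro sum.cong) (auto simp: increments_def)
  also have "\<dots> = Y (t k) \<omega> - Y (t m) \<omega>"
    using sum_Suc_diff'[OF assms(2), of "\<lambda>i. Y (t i) \<omega>"] by simp
  finally show ?thesis .
qed

text \<open>Two finite measures on the product space agree once they agree on finite-dimensional
  cylinders, and the coordinates in a cylinder are partial sums of increments along one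
  grid.\<close>

lemma distr_shift:
  assumes s: "0 \<le> s"
  shows "distr M path_space (shift s) = distr M path_space (shift 0)"
proof (rule measure_eqI_PiM_infinite[where I="{0..}" and M="\<lambda>_. borel"])
  show "finite_measure (distr M path_space (shift s))"
    using s by (intro finite_measure_distr) simp
  fix J :: "real set" and A :: "real \<Rightarrow> real set"
  assume J: "finite J" "J \<subseteq> {0..}" and A: "\<And>i. i \<in> J \<Longrightarrow> A i \<in> sets borel"
  obtain t :: "nat \<Rightarrow> real" and n where t: "mono t" "t 0 = 0" "0 < n" "J \<subseteq> t ` {..<n}"
    using finite_times_grid[OF J] .
  then have "\<forall>j\<in>J. \<exists>i<n. t i = j" by auto
  then obtain k where k: "\<And>j. j \<in> J \<Longrightarrow> k j < n \<and> t (k j) = j" by metis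
  \<comment> \<open>The cylinder becomes a set of increment vectors that does not mention the
    starting time u; the claim \<open>cyl\<close> then gives a value independent of u.\<close>
  define W where "W = {d \<in> space (\<Pi>\<^sub>M i\<in>{..<n}. (borel::real measure)). \<forall>j\<in>J. (\<Sum>i=0..<k j. d i) \<in> A j}"
  have W: "W \<in> sets (\<Pi>\<^sub>M i\<in>{..<n}. borel)"
    unfolding W_def
  proof (intro sets.sets_Collect_finite_All J(1))
    fix j assume "j \<in> J"
    have "(\<lambda>d. \<Sum>i=0..<k j. d i) \<in> borel_measurable (\<Pi>\<^sub>M i\<in>{..<n}. (borel::real measure))"
      using k[OF \<open>j \<in> J\<close>] by (intro borel_measurable_sum measurable_component_singleton) auto
    from measurable_sets[OF this A[OF \<open>j \<in> J\<close>]]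
    show "{d \<in> space (\<Pi>\<^sub>M i\<in>{..<n}. (borel::real measure)). (\<Sum>i=0..<k j. d i) \<in> A j} \<in> sets (\<Pi>\<^sub>M i\<in>{..<n}. borel)"
      by (simp add: vimage_def Int_def conj_commute)
  qed
  have cyl: "emeasure (distr M path_space (shift u)) (prod_emb {0..} (\<lambda>_. borel) J (Pi\<^sub>E J A)) =
      emeasure (\<Pi>\<^sub>M i\<in>{..<n}. distr M borel (Y (t (Suc i) - t i))) W" if u: "0 \<le> u" for u
  proof -
    let ?t = "\<lambda>i. u + t i"
    have t': "mono ?t" "0 \<le> ?t 0" using t u by (auto simp: mono_def)
    have m: "prod_emb {0..} (\<lambda>_. borel) J (Pi\<^sub>E J A) \<in> sets path_space"
      using J A by (intro sets_PiM_I) auto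
    have "shift u -` prod_emb {0..} (\<lambda>_. borel) J (Pi\<^sub>E J A) \<inter> space M =
      increments ?t {..<n} -` W \<inter> space M"
    proof -
      have "shift u \<omega> \<in> prod_emb {0..} (\<lambda>_. borel) J (Pi\<^sub>E J A) \<longleftrightarrow> increments ?t {..<n} \<omega> \<in> W"
        if "\<omega> \<in> space M" for \<omega>
      proof -
        have "shift u \<omega> \<in> prod_emb {0..} (\<lambda>_. borel) J (Pi\<^sub>E J A) \<longleftrightarrow>
          (\<forall>j\<in>J. Y (u + j) \<omega> - Y u \<omega> \<in> A j)"
          using J(2) by (auto simp: prod_emb_iff shift_def PiE_iff extensional_def subset_eq)
        also have "\<dots> \<longleftrightarrow> (\<forall>j\<in>J. (\<Sum>i=0..<k j. increments ?t {..<n} \<omega> i) \<in> A j)"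
        proof (intro ball_cong refl)
          fix j assume j: "j \<in> J"
          have "{0..<k j} \<subseteq> {..<n}" using k[OF j] by auto
          then show "Y (u + j) \<omega> - Y u \<omega> \<in> A j \<longleftrightarrow> (\<Sum>i=0..<k j. increments ?t {..<n} \<omega> i) \<in> A j"
            using k[OF j] t(2) by (simp add: sum_increments)
        qed
        also have "\<dots> \<longleftrightarrow> increments ?t {..<n} \<omega> \<in> W"
          by (auto simp: W_def space_PiM increments_def)
        finally show ?thesis .
      qed
      then show ?thesis by auto
    qed
    then have "emeasure (distr M path_space (shift u)) (prod_emb {0..} (\<lambda>_. borel) J (Pi\<^sub>E J A)) =
      emeasure (distr M (\<Pi>\<^sub>M i\<in>{..<n}. borel) (increments ?t {..<n})) W"
      using u m W t' by (simp add: emeasure_distr)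
    then show ?thesis
      using distr_increments[OF t' t(3)] by simp
  qed
  show "emeasure (distr M path_space (shift s)) (prod_emb {0..} (\<lambda>_. borel) J (Pi\<^sub>E J A)) =
    emeasure (distr M path_space (shift 0)) (prod_emb {0..} (\<lambda>_. borel) J (Pi\<^sub>E J A))"
    using cyl[of s] cyl[of 0] s by simp
qed simp_all

text \<open>Cylinder events form intersection-stable generators on both sides, so independence is
  checked on cylinders. A pair of cylinders is read off one grid containing s: increments before s
  determine the first, increments after s the second, and the two blocks are independent.\<close>

lemma indep_past_shift:
  assumes s: "0 \<le> s"
  shows "indep_var (\<Pi>\<^sub>M t\<in>{0..s}. borel) (past s) path_space (shift s)"
proof -
  let ?P = "{past s -` A \<inter> space M | A. A \<in> prod_algebra {0..s} (\<lambda>_. borel)}"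
  let ?F = "{shift s -` A \<inter> space M | A. A \<in> prod_algebra {0..} (\<lambda>_. borel)}"
  have stable: "Int_stable {X -` A \<inter> space M | A. A \<in> prod_algebra I (\<lambda>_. borel)}"
    for X :: "'a \<Rightarrow> real \<Rightarrow> real" and I
  proof (rule Int_stableI, clarify)
    fix A B :: "(real \<Rightarrow> real) set"
    assume "A \<in> prod_algebra I (\<lambda>_. borel)" "B \<in> prod_algebra I (\<lambda>_. borel)"
    then have "A \<inter> B \<in> prod_algebra I (\<lambda>_. borel)"
      using Int_stable_prod_algebra[of I "\<lambda>_. borel"] by (auto simp: Int_stable_def)
    moreover have "X -` A \<inter> space M \<inter> (X -` B \<inter> space M) = X -` (A \<inter> B) \<inter> space M" by auto
    ultimately show "\<exists>C. X -` A \<inter> space M \<inter> (X -` B \<inter> space M) = X -` C \<inter> space M \<and>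
        C \<in> prod_algebra I (\<lambda>_. borel)" by blast
  qed
  have gen: "sigma_sets (space M) {X -` A \<inter> space M | A. A \<in> sets (\<Pi>\<^sub>M i\<in>I. borel)} =
      sigma_sets (space M) {X -` A \<inter> space M | A. A \<in> prod_algebra I (\<lambda>_. borel)}"
    if X: "X \<in> measurable M (\<Pi>\<^sub>M i\<in>I. borel)" for X :: "'a \<Rightarrow> real \<Rightarrow> real" and I
  proof -
    have "sigma_sets (space M) {X -` A \<inter> space M | A. A \<in> sets (\<Pi>\<^sub>M i\<in>I. borel)} =
      sigma_sets (space M) (sigma_sets (space M) {X -` A \<inter> space M | A. A \<in> prod_algebra I (\<lambda>_. borel)})"
      using measurable_space[OF X] unfolding sets_PiM
      by (subst sigma_sets_vimage_commute) (auto simp: space_PiM)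
    also have "\<dots> = sigma_sets (space M) {X -` A \<inter> space M | A. A \<in> prod_algebra I (\<lambda>_. borel)}"
      by (rule sigma_sets_sigma_sets_eq) auto
    finally show ?thesis .
  qed
  have "indep_set ?P ?F"
    unfolding indep_sets2_eq
  proof (intro conjI ballI)
    show "?P \<subseteq> events"
      using measurable_sets[OF measurable_past[of s]] by (auto simp: sets_PiM intro: sigma_sets.Basic)
    show "?F \<subseteq> events"
      using measurable_sets[OF measurable_shift[OF s]] by (auto simp: sets_PiM intro: sigma_sets.Basic)
    fix a b assume "a \<in> ?P" "b \<in> ?F"
    then obtain A B where AB: "a = past s -` A \<inter> space M" "b = shift s -` B \<inter> space M"
      "A \<in> prod_algebra {0..s} (\<lambda>_. borel)" "B \<in> prod_algebra {0..} (\<lambda>_. borel)" by auto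
    obtain J E where J: "A = prod_emb {0..s} (\<lambda>_. borel) J (Pi\<^sub>E J E)" "finite J" "J \<subseteq> {0..s}"
      "\<And>i. i \<in> J \<Longrightarrow> E i \<in> sets borel"
      using AB(3) by (rule prod_algebraE) auto
    obtain J' E' where J': "B = prod_emb {0..} (\<lambda>_. borel) J' (Pi\<^sub>E J' E')" "finite J'" "J' \<subseteq> {0..}"
      "\<And>i. i \<in> J' \<Longrightarrow> E' i \<in> sets borel"
      using AB(4) by (rule prod_algebraE) auto
    define F where "F = insert s (J \<union> (\<lambda>j. s + j) ` J')"
    have "finite F" "F \<subseteq> {0..}" using J(2,3) J'(2,3) s by (auto simp: F_def)
    then obtain t :: "nat \<Rightarrow> real" and n where t: "mono t" "t 0 = 0" "0 < n" "F \<subseteq> t ` {..<n}"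
      using finite_times_grid by metis
    have "s \<in> t ` {..<n}" using t(4) by (auto simp: F_def)
    then obtain m where m: "t m = s" "m < n" by auto
    \<comment> \<open>The grid is known to be monotone, not strictly so. An index found for j may
      lie beyond m, but then j equals s and m itself serves; the same care is taken for the future
      times.\<close>
    have "\<exists>i\<le>m. t i = j" if "j \<in> J" for j
    proof -
      have "j \<in> t ` {..<n}" using that t(4) by (auto simp: F_def)
      then obtain i where i: "t i = j" "i < n" by auto
      show ?thesis
      proof (cases "i \<le> m")
        case False
        then have "t m \<le> t i" by (intro monoD[OF t(1)]) auto
        moreover have "j \<le> s" using J(3) that by auto
        ultimately have "t m = j" using m(1) i(1) by linarith
        then show ?thesis by (intro exI[of _ m]) simp
      next
        case True
        then show ?thesis using i by blast
      qed
    qed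
    then obtain k where k: "\<And>j. j \<in> J \<Longrightarrow> k j \<le> m \<and> t (k j) = j" by metis
    have "\<exists>i\<ge>m. i < n \<and> t i = s + j" if "j \<in> J'" for j
    proof -
      have "s + j \<in> t ` {..<n}" using that t(4) by (auto simp: F_def)
      then obtain i where i: "t i = s + j" "i < n" by auto
      show ?thesis
      proof (cases "m \<le> i")
        case False
        then have "t i \<le> t m" by (intro monoD[OF t(1)]) auto
        moreover have "0 \<le> j" using J'(3) that by auto
        ultimately have "t m = s + j" using m(1) i(1) by linarith
        then show ?thesis using m(2) by (intro exI[of _ m]) simp
      next
        case True
        then show ?thesis using i by blast
      qed
    qed
    then obtain k' where k': "\<And>j. j \<in> J' \<Longrightarrow> m \<le> k' j \<and> k' j < n \<and> t (k' j) = s + j" by metis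
    let ?D1 = "\<Pi>\<^sub>M i\<in>{..<m}. (borel :: real measure)" and ?D2 = "\<Pi>\<^sub>M i\<in>{m..<n}. (borel :: real measure)"
    define W where "W = {d \<in> space ?D1. \<forall>j\<in>J. (\<Sum>i=0..<k j. d i) \<in> E j}"
    define W' where "W' = {d \<in> space ?D2. \<forall>j\<in>J'. (\<Sum>i=m..<k' j. d i) \<in> E' j}"
    have W: "W \<in> sets ?D1"
      unfolding W_def
    proof (intro sets.sets_Collect_finite_All J(2))
      fix j assume "j \<in> J"
      have "(\<lambda>d. \<Sum>i=0..<k j. d i) \<in> borel_measurable ?D1"
        using k[OF \<open>j \<in> J\<close>] by (intro borel_measurable_sum measurable_component_singleton) auto
      from measurable_sets[OF this J(4)[OF \<open>j \<in> J\<close>]]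
      show "{d \<in> space ?D1. (\<Sum>i=0..<k j. d i) \<in> E j} \<in> sets ?D1"
        by (simp add: vimage_def Int_def conj_commute)
    qed
    have W': "W' \<in> sets ?D2"
      unfolding W'_def
    proof (intro sets.sets_Collect_finite_All J'(2))
      fix j assume "j \<in> J'"
      have "(\<lambda>d. \<Sum>i=m..<k' j. d i) \<in> borel_measurable ?D2"
        using k'[OF \<open>j \<in> J'\<close>] by (intro borel_measurable_sum measurable_component_singleton) auto
      from measurable_sets[OF this J'(4)[OF \<open>j \<in> J'\<close>]]
      show "{d \<in> space ?D2. (\<Sum>i=m..<k' j. d i) \<in> E' j} \<in> sets ?D2"
        by (simp add: vimage_def Int_def conj_commute)
    qed
    have a: "a = increments t {..<m} -` W \<inter> space M"
    proof -
      have "past s \<omega> \<in> A \<longleftrightarrow> increments t {..<m} \<omega> \<in> W" if w: "\<omega> \<in> space M" for \<omega>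
      proof -
        have "past s \<omega> \<in> A \<longleftrightarrow> (\<forall>j\<in>J. Y j \<omega> \<in> E j)"
          using J(3) by (auto simp: J(1) prod_emb_iff past_def PiE_iff extensional_def subset_eq)
        also have "\<dots> \<longleftrightarrow> (\<forall>j\<in>J. (\<Sum>i=0..<k j. increments t {..<m} \<omega> i) \<in> E j)"
        proof (intro ball_cong refl)
          fix j assume j: "j \<in> J"
          have "{0..<k j} \<subseteq> {..<m}" using k[OF j] by auto
          then show "Y j \<omega> \<in> E j \<longleftrightarrow> (\<Sum>i=0..<k j. increments t {..<m} \<omega> i) \<in> E j"
            using k[OF j] t(2) start[OF w] by (simp add: sum_increments)
        qed
        also have "\<dots> \<longleftrightarrow> increments t {..<m} \<omega> \<in> W"
          by (auto simp: W_def space_PiM increments_def)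
        finally show ?thesis .
      qed
      then show ?thesis by (auto simp: AB(1))
    qed
    have b: "b = increments t {m..<n} -` W' \<inter> space M"
    proof -
      have "shift s \<omega> \<in> B \<longleftrightarrow> increments t {m..<n} \<omega> \<in> W'" if w: "\<omega> \<in> space M" for \<omega>
      proof -
        have "shift s \<omega> \<in> B \<longleftrightarrow> (\<forall>j\<in>J'. Y (s + j) \<omega> - Y s \<omega> \<in> E' j)"
          using J'(3) by (auto simp: J'(1) prod_emb_iff shift_def PiE_iff extensional_def subset_eq)
        also have "\<dots> \<longleftrightarrow> (\<forall>j\<in>J'. (\<Sum>i=m..<k' j. increments t {m..<n} \<omega> i) \<in> E' j)"
        proof (intro ball_cong refl)
          fix j assume j: "j \<in> J'"
          have "{m..<k' j} \<subseteq> {m..<n}" using k'[OF j] by auto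
          then show "Y (s + j) \<omega> - Y s \<omega> \<in> E' j \<longleftrightarrow> (\<Sum>i=m..<k' j. increments t {m..<n} \<omega> i) \<in> E' j"
            using k'[OF j] m by (simp add: sum_increments)
        qed
        also have "\<dots> \<longleftrightarrow> increments t {m..<n} \<omega> \<in> W'"
          by (auto simp: W'_def space_PiM increments_def)
        finally show ?thesis .
      qed
      then show ?thesis by (auto simp: AB(2))
    qed
    have "prob ((\<lambda>\<omega>. (increments t {..<m} \<omega>, increments t {m..<n} \<omega>)) -` (W \<times> W') \<inter> space M) =
      prob (increments t {..<m} -` W \<inter> space M) * prob (increments t {m..<n} -` W' \<inter> space M)"
      using indep_varD[OF indep_var_increments[OF t(1)] W W'] t(2) by simp
    moreover have "(\<lambda>\<omega>. (increments t {..<m} \<omega>, increments t {m..<n} \<omega>)) -` (W \<times> W') \<inter> space M = a \<inter> b"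
      by (auto simp: a b)
    ultimately show "prob (a \<inter> b) = prob a * prob b"
      by (simp add: a b)
  qed
  then have "indep_set (sigma_sets (space M) ?P) (sigma_sets (space M) ?F)"
    by (intro indep_set_sigma_sets stable)
  then show ?thesis
    unfolding indep_var_eq using s by (simp add: gen)
qed

text \<open>The Markov property in the form used later: on the right, the future after s is replaced
  by the whole path.\<close>

lemma prob_past_shift:
  assumes s: "0 \<le> s"
    and [measurable]: "Measurable.pred (\<Pi>\<^sub>M t\<in>{0..s}. borel) Q" "Measurable.pred path_space R"
  shows "prob {\<omega> \<in> space M. Q (past s \<omega>) \<and> R (shift s \<omega>)} =
    prob {\<omega> \<in> space M. Q (past s \<omega>)} * prob {\<omega> \<in> space M. R (shift 0 \<omega>)}"
proof -
  let ?S = "\<Pi>\<^sub>M t\<in>{0..s}. (borel :: real measure)"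
  have m: "{f \<in> space ?S. Q f} \<in> sets ?S" "{f \<in> space path_space. R f} \<in> sets path_space"
    by measurable
  have sp: "past s \<omega> \<in> space ?S" "shift u \<omega> \<in> space path_space" for u \<omega>
    by (auto simp: space_PiM past_def shift_def)
  have "prob {\<omega> \<in> space M. Q (past s \<omega>) \<and> R (shift s \<omega>)} =
    prob {\<omega> \<in> space M. Q (past s \<omega>)} * prob {\<omega> \<in> space M. R (shift s \<omega>)}"
    using indep_varD[OF indep_past_shift[OF s] m] sp by (simp add: vimage_def Int_def conj_commute)
  also have "prob {\<omega> \<in> space M. R (shift s \<omega>)} = measure (distr M path_space (shift s)) {f \<in> space path_space. R f}"
    using s sp m by (subst measure_distr) (auto simp: vimage_def Int_def conj_commute)
  also have "\<dots> = prob {\<omega> \<in> space M. R (shift 0 \<omega>)}"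
    using sp m unfolding distr_shift[OF s] by (subst measure_distr) (auto simp: vimage_def Int_def conj_commute)
  finally show ?thesis .
qed

lemma prob_shift:
  assumes s: "0 \<le> s" and [measurable]: "Measurable.pred path_space R"
  shows "prob {\<omega> \<in> space M. R (shift s \<omega>)} = prob {\<omega> \<in> space M. R (shift 0 \<omega>)}"
  using prob_past_shift[OF s, of "\<lambda>_. True" R] by (simp add: prob_space)

end

section \<open>The exponential functional as a functional of the path\<close>

lemma cadlag_right_tendsto: "cadlag f \<Longrightarrow> 0 \<le> t \<Longrightarrow> (f \<longlongrightarrow> f t) (at_right t)"
  by (simp add: cadlag_def)

text \<open>Rational times make this an event of the product sigma-algebra. The interval is
  half-open because right-continuity transfers the condition from rationals to each u < s but says
  nothing about s itself; the end point is always treated as a separate condition.\<close>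

definition stays_in :: "real set \<Rightarrow> real \<Rightarrow> (real \<Rightarrow> real) \<Rightarrow> bool" where
  "stays_in C s f \<longleftrightarrow> (\<forall>q\<in>\<rat> \<inter> {0..<s}. f q \<in> C)"

text \<open>The complement of C is open, so a violation at u persists on an interval to the right of
  u, and that interval contains a rational time.\<close>

lemma stays_in_iff:
  assumes f: "\<And>t. 0 \<le> t \<Longrightarrow> (f \<longlongrightarrow> f t) (at_right t)" and C: "closed C"
  shows "stays_in C s f \<longleftrightarrow> (\<forall>u\<in>{0..<s}. f u \<in> C)"
proof
  assume s: "stays_in C s f"
  show "\<forall>u\<in>{0..<s}. f u \<in> C"
  proof (rule ballI, rule ccontr)
    fix u assume u: "u \<in> {0..<s}" "f u \<notin> C"
    have "\<forall>\<^sub>F v in at_right u. f v \<in> - C"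
      using f[of u] u C by (intro topological_tendstoD) auto
    moreover have "\<forall>\<^sub>F v in at_right u. v < s"
      using u by (auto simp: eventually_at_right intro!: exI[of _ s])
    ultimately have "\<forall>\<^sub>F v in at_right u. f v \<in> - C \<and> v < s"
      by eventually_elim auto
    then obtain b where b: "u < b" "\<And>v. u < v \<Longrightarrow> v < b \<Longrightarrow> f v \<in> - C \<and> v < s"
      by (auto simp: eventually_at_right_field)
    obtain q where "q \<in> \<rat>" "u < q" "q < b" using Rats_dense_in_real[OF b(1)] by auto
    with s b(2)[of q] u show False by (auto simp: stays_in_def)
  qed
qed (auto simp: stays_in_def)

lemma stays_in_cong: "(\<And>u. 0 \<le> u \<Longrightarrow> u < s \<Longrightarrow> f u = g u) \<Longrightarrow> stays_in C s f = stays_in C s g"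
  by (auto simp: stays_in_def)

lemma measurable_stays_in:
  assumes "{0..<s} \<subseteq> I" "C \<in> sets borel"
  shows "Measurable.pred (\<Pi>\<^sub>M t\<in>I. borel) (stays_in C s)"
proof -
  have "countable (\<rat> \<inter> {0..<s::real})" using countable_rat by (rule countable_subset[rotated]) auto
  moreover have "Measurable.pred (\<Pi>\<^sub>M t\<in>I. borel) (\<lambda>f. f q \<in> C)" if "q \<in> \<rat> \<inter> {0..<s}" for q :: real
    using assms that by (intro measurable_sets_Collect[OF measurable_component_singleton, unfolded pred_def[symmetric]]
        pred_sets2[OF assms(2)] measurable_component_singleton) auto
  ultimately show ?thesis
    unfolding stays_in_def[abs_def] by (rule measurable_pred_countable(1))
qed

text \<open>For t \<ge> 0 this is the first multiple of 1/(n+1) strictly above t. Strictness makes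
  it approach t from the right, and for fixed n it takes countably many values, whence the joint
  measurability of the evaluation at this time.\<close>

definition grid_right :: "nat \<Rightarrow> real \<Rightarrow> real" where
  "grid_right n t = real (Suc (nat \<lfloor>t * real (Suc n)\<rfloor>)) / real (Suc n)"

lemma grid_right_tendsto:
  assumes "0 \<le> t"
  shows "filterlim (\<lambda>n. grid_right n t) (at_right t) sequentially"
proof -
  have b: "t < grid_right n t" "grid_right n t \<le> t + 1 / real (Suc n)" for n
  proof -
    have "real (nat \<lfloor>t * real (Suc n)\<rfloor>) = of_int \<lfloor>t * real (Suc n)\<rfloor>" using assms by simp
    then have "t * real (Suc n) < real (Suc (nat \<lfloor>t * real (Suc n)\<rfloor>))"
      "real (Suc (nat \<lfloor>t * real (Suc n)\<rfloor>)) \<le> t * real (Suc n) + 1" by linarith+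
    then show "t < grid_right n t" "grid_right n t \<le> t + 1 / real (Suc n)"
      by (simp_all add: grid_right_def field_simps del: of_nat_Suc)
  qed
  have "(\<lambda>n. t + 1 / real (Suc n)) \<longlonglongrightarrow> t + 0"
    by (intro tendsto_intros LIMSEQ_inverse_real_of_nat[unfolded inverse_eq_divide])
  then have "(\<lambda>n. grid_right n t) \<longlonglongrightarrow> t"
    using tendsto_sandwich[OF _ _ tendsto_const, of t "\<lambda>n. grid_right n t" sequentially "\<lambda>n. t + 1 / real (Suc n)"] b
    by (simp add: less_imp_le del: of_nat_Suc)
  moreover have "\<forall>\<^sub>F n in sequentially. grid_right n t \<in> {t<..} \<and> grid_right n t \<noteq> t"
    using b(1) by (intro always_eventually) (simp add: less_imp_neq[symmetric])
  ultimately show ?thesis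
    unfolding filterlim_at by simp
qed

text \<open>Recovers a right-continuous path from countably many coordinates, measurably in the
  path and in time. This makes functionals of the path measurable on the product space.\<close>

definition right_eval :: "real \<Rightarrow> (real \<Rightarrow> real) \<Rightarrow> real" where
  "right_eval t f = lim (\<lambda>n. f (grid_right n t))"

lemma right_eval_eq:
  "0 \<le> t \<Longrightarrow> (f \<longlongrightarrow> l) (at_right t) \<Longrightarrow> right_eval t f = l"
  unfolding right_eval_def using filterlim_compose[OF _ grid_right_tendsto] by (rule limI)

lemma measurable_right_eval:
  "(\<lambda>(t, f). right_eval t f) \<in> borel_measurable (borel \<Otimes>\<^sub>M path_space)"
proof -
  have "(\<lambda>(t, f). f (grid_right n t)) \<in> borel_measurable (borel \<Otimes>\<^sub>M path_space)" for n
  proof -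
    have "(\<lambda>x. snd x (real (Suc (nat \<lfloor>fst x * real (Suc n)\<rfloor>)) / real (Suc n)))
        \<in> borel_measurable (borel \<Otimes>\<^sub>M path_space)"
    proof (rule measurable_compose_countable[where f="\<lambda>k x. snd x (real (Suc k) / real (Suc n))"])
      show "(\<lambda>x. snd x (real (Suc k) / real (Suc n))) \<in> borel_measurable (borel \<Otimes>\<^sub>M path_space)" for k
        by (rule measurable_compose[OF measurable_snd measurable_component_singleton]) auto
      show "(\<lambda>x. nat \<lfloor>fst x * real (Suc n)\<rfloor>) \<in> measurable (borel \<Otimes>\<^sub>M path_space) (count_space UNIV)"
        by measurable
    qed
    then show ?thesis by (simp add: grid_right_def case_prod_beta)
  qed
  then have "(\<lambda>x. lim (\<lambda>n. (\<lambda>(t, f). f (grid_right n t)) x)) \<in> borel_measurable (borel \<Otimes>\<^sub>M path_space)"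
    by (intro borel_measurable_lim_metric)
  then show ?thesis by (simp add: right_eval_def case_prod_beta)
qed

text \<open>\<open>right_eval\<close> has the type of a process whose sample points are paths, so
  \<open>exp_functional right_eval\<close> is the exponential functional as a function of the
  path.\<close>

lemma measurable_exp_functional_right_eval [measurable]:
  "exp_functional right_eval \<in> borel_measurable path_space"
proof -
  have m': "(\<lambda>x. right_eval (snd x) (fst x)) \<in> borel_measurable (path_space \<Otimes>\<^sub>M borel)"
    by (rule measurable_Pair_compose_split[OF measurable_right_eval measurable_snd measurable_fst])
  have eq: "sets (path_space \<Otimes>\<^sub>M lborel) = sets (path_space \<Otimes>\<^sub>M (borel :: real measure))"
    by (intro sets_pair_measure_cong) auto
  have m: "(\<lambda>x. right_eval (snd x) (fst x)) \<in> borel_measurable (path_space \<Otimes>\<^sub>M lborel)"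
    by (subst measurable_cong_sets[OF eq refl]) (rule m')
  have "(\<lambda>x. ennreal (exp (- right_eval (snd x) (fst x))) * indicator {0..} (snd x))
      \<in> borel_measurable (path_space \<Otimes>\<^sub>M lborel)"
  proof (rule borel_measurable_times_ennreal)
    have "(\<lambda>y::real. ennreal (exp (- y))) \<in> borel_measurable borel" by measurable
    then show "(\<lambda>x. ennreal (exp (- right_eval (snd x) (fst x)))) \<in> borel_measurable (path_space \<Otimes>\<^sub>M lborel)"
      by (rule measurable_compose[OF m])
    have "(indicator {0..} :: real \<Rightarrow> ennreal) \<in> borel_measurable lborel" by simp
    then show "(\<lambda>x. indicator {0..} (snd x :: real) :: ennreal) \<in> borel_measurable (path_space \<Otimes>\<^sub>M lborel)"
      by (rule measurable_compose[OF measurable_snd])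
  qed
  then show ?thesis
    unfolding exp_functional_def[abs_def]
    by (intro lborel.borel_measurable_nn_integral) (simp add: case_prod_beta)
qed

context levy_process
begin

lemma right_tendsto:
  assumes "\<omega> \<in> space M" "0 \<le> t"
  shows "((\<lambda>u. Y u \<omega>) \<longlongrightarrow> Y t \<omega>) (at_right t)"
  using cadlag_right_tendsto[OF paths[OF assms(1)] assms(2)] .

lemma shift_tendsto:
  assumes "\<omega> \<in> space M" "0 \<le> s" "0 \<le> t"
  shows "(shift s \<omega> \<longlongrightarrow> shift s \<omega> t) (at_right t)"
proof -
  have "filterlim (\<lambda>u. s + u) (at_right (s + t)) (at_right t)"
    unfolding filterlim_at
    by (intro conjI tendsto_intros eventually_mono[OF eventually_at_right_less[of t]]) auto
  then have "((\<lambda>u. Y (s + u) \<omega> - Y s \<omega>) \<longlongrightarrow> Y (s + t) \<omega> - Y s \<omega>) (at_right t)"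
    using assms by (intro tendsto_intros filterlim_compose[OF right_tendsto[OF assms(1)]]) auto
  then show ?thesis
    using assms(3)
    by (rule_tac Lim_transform_eventually) (auto simp: shift_def eventually_at_right_field intro!: exI[of _ "t+1"])
qed

lemma stays_in_shift_iff:
  assumes "\<omega> \<in> space M" "0 \<le> s" "closed C"
  shows "stays_in C r (shift s \<omega>) \<longleftrightarrow> (\<forall>u\<in>{0..<r}. Y (s + u) \<omega> - Y s \<omega> \<in> C)"
  using stays_in_iff[OF shift_tendsto[OF assms(1,2)] assms(3)] by (auto simp: shift_def)

lemma past_apply: "0 \<le> t \<Longrightarrow> t \<le> s \<Longrightarrow> past s \<omega> t = Y t \<omega>"
  by (simp add: past_def)

lemma shift_apply: "0 \<le> t \<Longrightarrow> shift s \<omega> t = Y (s + t) \<omega> - Y s \<omega>"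
  by (simp add: shift_def)

lemma stays_in_past_iff:
  assumes "\<omega> \<in> space M" "r \<le> s" "closed C"
  shows "stays_in C r (past s \<omega>) \<longleftrightarrow> (\<forall>u\<in>{0..<r}. Y u \<omega> \<in> C)"
proof -
  have "stays_in C r (past s \<omega>) = stays_in C r (\<lambda>u. Y u \<omega>)"
    using assms(2) by (intro stays_in_cong) (auto simp: past_def)
  then show ?thesis
    using stays_in_iff[OF right_tendsto[OF assms(1)] assms(3)] by simp
qed

lemma right_eval_shift:
  assumes "\<omega> \<in> space M" "0 \<le> s" "0 \<le> t"
  shows "right_eval t (shift s \<omega>) = Y (s + t) \<omega> - Y s \<omega>"
  using right_eval_eq[OF assms(3) shift_tendsto[OF assms]] assms(3) by (simp add: shift_def)

lemma exp_functional_eq: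
  assumes "\<omega> \<in> space M"
  shows "exp_functional Y \<omega> = exp_functional right_eval (shift 0 \<omega>)"
  unfolding exp_functional_def
  by (intro nn_integral_cong) (simp add: right_eval_shift[OF assms] start[OF assms] indicator_def)

lemma measurable_exp_functional [measurable]: "exp_functional Y \<in> borel_measurable M"
proof -
  have "(\<lambda>\<omega>. exp_functional right_eval (shift 0 \<omega>)) \<in> borel_measurable M" by measurable
  then show ?thesis by (simp add: exp_functional_eq cong: measurable_cong)
qed

lemma measurable_path [measurable]:
  assumes "\<omega> \<in> space M"
  shows "(\<lambda>t. Y t \<omega> * indicator {0..} t) \<in> borel_measurable borel"
proof -
  have "(\<lambda>t. right_eval t (shift 0 \<omega>) * indicator {0..} t) \<in> borel_measurable borel"
    using measurable_Pair_compose_split[OF measurable_right_eval measurable_ident measurable_const, of "shift 0 \<omega>"]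
    by (auto simp: space_PiM shift_def)
  also have "(\<lambda>t. right_eval t (shift 0 \<omega>) * indicator {0..} t) = (\<lambda>t. Y t \<omega> * indicator {0..} t)"
    using assms by (auto simp: right_eval_shift start fun_eq_iff indicator_def)
  finally show ?thesis .
qed

lemma exp_functional_split:
  assumes w: "\<omega> \<in> space M" and s: "0 \<le> s"
  shows "exp_functional Y \<omega> = (\<integral>\<^sup>+ t\<in>{0..<s}. ennreal (exp (- Y t \<omega>)) \<partial>lborel) +
    ennreal (exp (- Y s \<omega>)) * exp_functional right_eval (shift s \<omega>)"
proof -
  \<comment> \<open>Values at negative times are arbitrary, so measurability in time is available
    for the path cut off to the half-line.\<close>
  let ?y = "\<lambda>t. Y t \<omega> * indicator {0..} t"
  note measurable_path[OF w, measurable]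
  have "exp_functional Y \<omega> = (\<integral>\<^sup>+ t. ennreal (exp (- ?y t)) * indicator {0..<s} t +
      ennreal (exp (- ?y t)) * indicator {s..} t \<partial>lborel)"
    unfolding exp_functional_def using s by (intro nn_integral_cong) (auto simp: indicator_def)
  also have "\<dots> = (\<integral>\<^sup>+ t. ennreal (exp (- ?y t)) * indicator {0..<s} t \<partial>lborel) +
      (\<integral>\<^sup>+ t. ennreal (exp (- ?y t)) * indicator {s..} t \<partial>lborel)"
    by (intro nn_integral_add) measurable
  also have "(\<integral>\<^sup>+ t. ennreal (exp (- ?y t)) * indicator {0..<s} t \<partial>lborel) =
      (\<integral>\<^sup>+ t\<in>{0..<s}. ennreal (exp (- Y t \<omega>)) \<partial>lborel)"
    by (intro nn_integral_cong) (auto simp: indicator_def)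
  also have "(\<integral>\<^sup>+ t. ennreal (exp (- ?y t)) * indicator {s..} t \<partial>lborel) =
      (\<integral>\<^sup>+ t. ennreal (exp (- ?y (s + 1 * t))) * indicator {s..} (s + 1 * t) \<partial>lborel)"
    by (subst nn_integral_real_affine[where c=1 and t=s]) auto
  also have "\<dots> = (\<integral>\<^sup>+ t. ennreal (exp (- Y s \<omega>)) * (ennreal (exp (- right_eval t (shift s \<omega>))) * indicator {0..} t) \<partial>lborel)"
    using s by (intro nn_integral_cong)
      (auto simp: indicator_def right_eval_shift[OF w s] ennreal_mult[symmetric] exp_add[symmetric])
  also have "\<dots> = ennreal (exp (- Y s \<omega>)) * exp_functional right_eval (shift s \<omega>)"
  proof -
    have "shift s \<omega> \<in> space path_space" by (simp add: space_PiM shift_def)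
    then have [measurable]: "(\<lambda>t. right_eval t (shift s \<omega>)) \<in> borel_measurable lborel"
      using measurable_Pair_compose_split[OF measurable_right_eval measurable_ident measurable_const, of "shift s \<omega>"]
      by simp
    show ?thesis
      unfolding exp_functional_def by (intro nn_integral_cmult) measurable
  qed
  finally show ?thesis .
qed

lemma exp_functional_le:
  assumes w: "\<omega> \<in> space M" and s: "0 \<le> s"
    and above: "\<And>u. 0 \<le> u \<Longrightarrow> u < s \<Longrightarrow> - \<eta> \<le> Y u \<omega>" and final: "\<sigma> \<le> Y s \<omega>"
    and y: "exp_functional right_eval (shift s \<omega>) \<le> ennreal y" "0 \<le> y"
  shows "exp_functional Y \<omega> \<le> ennreal (s * exp \<eta> + exp (- \<sigma>) * y)"
proof -
  have "(\<integral>\<^sup>+ t\<in>{0..<s}. ennreal (exp (- Y t \<omega>)) \<partial>lborel) \<le> (\<integral>\<^sup>+ t. ennreal (exp \<eta>) * indicator {0..<s} t \<partial>lborel)"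
    using above by (intro nn_integral_mono) (force simp: indicator_def)
  also have "\<dots> = ennreal (s * exp \<eta>)"
    using s by (subst nn_integral_cmult_indicator) (auto simp: ennreal_mult[symmetric] mult.commute)
  finally have 1: "(\<integral>\<^sup>+ t\<in>{0..<s}. ennreal (exp (- Y t \<omega>)) \<partial>lborel) \<le> ennreal (s * exp \<eta>)" .
  have "ennreal (exp (- Y s \<omega>)) * exp_functional right_eval (shift s \<omega>) \<le> ennreal (exp (- \<sigma>)) * ennreal y"
    using final y by (intro mult_mono) auto
  also have "\<dots> = ennreal (exp (- \<sigma>) * y)" using y by (simp add: ennreal_mult)
  finally show ?thesis
    using add_mono[OF 1] s y by (simp add: exp_functional_split[OF w s])
qed

section \<open>The recursive inequality for the distribution function\<close>

abbreviation cdf :: "real \<Rightarrow> real" where "cdf \<equiv> cdf_exp_functional M Y"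

lemma cdf_eq: "cdf y = prob {\<omega> \<in> space M. exp_functional right_eval (shift 0 \<omega>) \<le> ennreal y}"
  unfolding cdf_exp_functional_def by (intro arg_cong[where f=prob] Collect_cong) (auto simp: exp_functional_eq)

lemma cdf_mono:
  assumes "x \<le> y"
  shows "cdf x \<le> cdf y"
  unfolding cdf_exp_functional_def
proof (rule finite_measure_mono)
  show "{\<omega> \<in> space M. exp_functional Y \<omega> \<le> ennreal x} \<subseteq> {\<omega> \<in> space M. exp_functional Y \<omega> \<le> ennreal y}"
    using order_trans[OF _ ennreal_leI[OF assms]] by blast
qed measurable

text \<open>Named after its use: a large jump before s forces the end value. The floor keeps the
  integral up to time s below s exp(\<eta>), and the end value damps the remaining integral by
  exp(-\<sigma>).\<close>

definition jump_prob :: "real \<Rightarrow> real \<Rightarrow> real \<Rightarrow> real" where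
  "jump_prob \<sigma> \<eta> s = prob {\<omega> \<in> space M. \<sigma> \<le> Y s \<omega> \<and> (\<forall>u\<in>{0..<s}. - \<eta> \<le> Y u \<omega>)}"

text \<open>All lower bounds come from this inequality with suitable \<sigma>, \<eta>, s and y. The
  event of \<open>jump_prob\<close> belongs to the past of s, while the functional of the
  independent future is at most y with probability \<open>cdf y\<close>.\<close>

lemma cdf_step:
  assumes s: "0 \<le> s" and y: "0 \<le> y"
  shows "jump_prob \<sigma> \<eta> s * cdf y \<le> cdf (s * exp \<eta> + exp (- \<sigma>) * y)"
proof -
  have Q: "Measurable.pred (\<Pi>\<^sub>M t\<in>{0..s}. borel) (\<lambda>f. \<sigma> \<le> f s \<and> stays_in {- \<eta>..} s f)"
  proof -
    have [measurable]: "(\<lambda>f. f s) \<in> borel_measurable (\<Pi>\<^sub>M t\<in>{0..s}. borel)"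
      using s by (intro measurable_component_singleton) auto
    have [measurable]: "Measurable.pred (\<Pi>\<^sub>M t\<in>{0..s}. borel) (stays_in {- \<eta>..} s)"
      by (intro measurable_stays_in) auto
    show ?thesis by measurable
  qed
  have R: "Measurable.pred path_space (\<lambda>f. exp_functional right_eval f \<le> ennreal y)" by measurable
  have "jump_prob \<sigma> \<eta> s * cdf y = prob {\<omega> \<in> space M. (\<sigma> \<le> past s \<omega> s \<and> stays_in {- \<eta>..} s (past s \<omega>)) \<and>
      exp_functional right_eval (shift s \<omega>) \<le> ennreal y}"
    unfolding prob_past_shift[OF s Q R] cdf_eq jump_prob_def using s
    by (intro arg_cong2[where f="(*)"] arg_cong[where f=prob] Collect_cong)
      (auto simp: stays_in_past_iff past_apply)
  also have "\<dots> \<le> cdf (s * exp \<eta> + exp (- \<sigma>) * y)"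
    unfolding cdf_exp_functional_def
  proof (rule finite_measure_mono)
    show "{\<omega> \<in> space M. (\<sigma> \<le> past s \<omega> s \<and> stays_in {- \<eta>..} s (past s \<omega>)) \<and>
      exp_functional right_eval (shift s \<omega>) \<le> ennreal y} \<subseteq>
      {\<omega> \<in> space M. exp_functional Y \<omega> \<le> ennreal (s * exp \<eta> + exp (- \<sigma>) * y)}"
    proof clarify
      fix \<omega> assume w: "\<omega> \<in> space M" "\<sigma> \<le> past s \<omega> s" "stays_in {- \<eta>..} s (past s \<omega>)"
        "exp_functional right_eval (shift s \<omega>) \<le> ennreal y"
      have "\<sigma> \<le> Y s \<omega>" using w(2) s by (simp add: past_apply)
      moreover have "\<forall>u\<in>{0..<s}. Y u \<omega> \<in> {- \<eta>..}"
        using w(3) stays_in_past_iff[OF w(1) order_refl, of "{- \<eta>..}" s] by simp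
      ultimately show "exp_functional Y \<omega> \<le> ennreal (s * exp \<eta> + exp (- \<sigma>) * y)"
        using w y s by (intro exp_functional_le) auto
    qed
  qed measurable
  finally show ?thesis .
qed

end

section \<open>Large increments and the L\'evy measure\<close>

context levy_process
begin

lemma sets_stays_in [measurable]:
  assumes "closed C"
  shows "{\<omega> \<in> space M. \<forall>u\<in>{0..<s}. Y u \<omega> \<in> C} \<in> events"
proof -
  have "Measurable.pred path_space (stays_in C s)"
    using assms by (intro measurable_stays_in) auto
  then have "{\<omega> \<in> space M. stays_in C s (shift 0 \<omega>)} \<in> events"
    by measurable
  moreover have "{\<omega> \<in> space M. stays_in C s (shift 0 \<omega>)} = {\<omega> \<in> space M. \<forall>u\<in>{0..<s}. Y u \<omega> \<in> C}"
    using assms by (auto simp: stays_in_shift_iff start)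
  ultimately show ?thesis by simp
qed

lemma sets_jump_prob:
  assumes "0 \<le> s"
  shows "{\<omega> \<in> space M. \<sigma> \<le> Y s \<omega> \<and> (\<forall>u\<in>{0..<s}. - \<eta> \<le> Y u \<omega>)} \<in> events"
proof -
  have "{\<omega> \<in> space M. \<sigma> \<le> Y s \<omega>} \<inter> {\<omega> \<in> space M. \<forall>u\<in>{0..<s}. Y u \<omega> \<in> {- \<eta>..}} \<in> events"
    using rv[OF assms] by (intro sets.Int sets_stays_in) auto
  also have "{\<omega> \<in> space M. \<sigma> \<le> Y s \<omega>} \<inter> {\<omega> \<in> space M. \<forall>u\<in>{0..<s}. Y u \<omega> \<in> {- \<eta>..}} =
    {\<omega> \<in> space M. \<sigma> \<le> Y s \<omega> \<and> (\<forall>u\<in>{0..<s}. - \<eta> \<le> Y u \<omega>)}" by auto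
  finally show ?thesis .
qed

text \<open>By right-continuity at 0 the events over shrinking intervals increase to the whole
  space. The bound 1/2 is a convenient choice; it enters twice in
  \<open>prob_first_big_increment\<close> and gives the factor 4 there.\<close>

lemma small_time:
  assumes "0 < \<tau>"
  obtains \<delta> where "0 < \<delta>" "prob {\<omega> \<in> space M. \<forall>u\<in>{0..<\<delta>}. Y u \<omega> \<in> {- \<tau>..\<tau>}} \<ge> 1 / 2"
proof -
  define A where "A n = {\<omega> \<in> space M. \<forall>u\<in>{0..<inverse (real (Suc n))}. Y u \<omega> \<in> {- \<tau>..\<tau>}}" for n
  have [measurable]: "A n \<in> events" for n
    unfolding A_def by (intro sets_stays_in) auto
  have "incseq A"
  proof (rule incseq_SucI)
    fix n
    have "inverse (real (Suc (Suc n))) \<le> inverse (real (Suc n))" by (intro le_imp_inverse_le) auto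
    then have "{0..<inverse (real (Suc (Suc n)))} \<subseteq> {0..<inverse (real (Suc n))}" by (intro ivl_subset[THEN iffD2]) simp
    then show "A n \<subseteq> A (Suc n)" unfolding A_def by blast
  qed
  then have lim: "(\<lambda>n. prob (A n)) \<longlonglongrightarrow> prob (\<Union>n. A n)"
    by (intro finite_Lim_measure_incseq) auto
  have "space M \<subseteq> (\<Union>n. A n)"
  proof
    fix \<omega> assume w: "\<omega> \<in> space M"
    have "((\<lambda>u. Y u \<omega>) \<longlongrightarrow> 0) (at_right 0)"
      using right_tendsto[OF w, of 0] start[OF w] by simp
    then have "\<forall>\<^sub>F u in at_right 0. dist (Y u \<omega>) 0 < \<tau>"
      using assms by (rule tendstoD)
    then obtain b where b: "0 < b" "\<And>u. 0 < u \<Longrightarrow> u < b \<Longrightarrow> \<bar>Y u \<omega>\<bar> < \<tau>"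
      by (auto simp: eventually_at_right_field)
    obtain n where n: "inverse (real (Suc n)) < b" using reals_Archimedean[OF b(1)] by blast
    have "Y u \<omega> \<in> {- \<tau>..\<tau>}" if "u \<in> {0..<inverse (real (Suc n))}" for u
      using that n b(2)[of u] start[OF w] assms by (cases "u = 0") auto
    then have "\<omega> \<in> A n" using w unfolding A_def by blast
    then show "\<omega> \<in> (\<Union>n. A n)" by blast
  qed
  then have "(\<Union>n. A n) = space M" by (auto simp: A_def)
  then have "\<forall>\<^sub>F n in sequentially. 1 / 2 < prob (A n)"
    using lim by (intro order_tendstoD(1)[OF lim]) (simp add: prob_space)
  then obtain n where "1 / 2 < prob (A n)" by (auto simp: eventually_sequentially)
  then show ?thesis
    by (intro that[of "inverse (real (Suc n))"]) (auto simp: A_def)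
qed

text \<open>What a jump of size at least L looks like from the ends of a short grid cell: the slack
  \<tau> absorbs the movement of the path before and after the jump within the cell.\<close>

definition big_increment :: "real \<Rightarrow> real \<Rightarrow> real \<Rightarrow> (real \<Rightarrow> real) \<Rightarrow> bool" where
  "big_increment L \<tau> h f \<longleftrightarrow> L - \<tau> \<le> f h \<and> stays_in {- \<tau>..} h f"

lemma measurable_big_increment:
  assumes "{0..h} \<subseteq> I" "0 \<le> h"
  shows "Measurable.pred (\<Pi>\<^sub>M t\<in>I. borel) (big_increment L \<tau> h)"
proof -
  have [measurable]: "(\<lambda>f. f h) \<in> borel_measurable (\<Pi>\<^sub>M t\<in>I. borel)"
    using assms by (intro measurable_component_singleton) auto
  have [measurable]: "Measurable.pred (\<Pi>\<^sub>M t\<in>I. borel) (stays_in {- \<tau>..} h)"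
    using assms by (intro measurable_stays_in) auto
  show ?thesis unfolding big_increment_def[abs_def] by measurable
qed

lemma big_increment_shift_iff:
  assumes "\<omega> \<in> space M" "0 \<le> s" "0 \<le> h"
  shows "big_increment L \<tau> h (shift s \<omega>) \<longleftrightarrow>
    L - \<tau> \<le> Y (s + h) \<omega> - Y s \<omega> \<and> (\<forall>u\<in>{0..<h}. - \<tau> \<le> Y (s + u) \<omega> - Y s \<omega>)"
  using assms by (simp add: big_increment_def stays_in_shift_iff shift_apply)

text \<open>Once the mesh is small, the path is within \<tau>/2 of its left limit before a jump time
  and within \<tau>/2 of its value after it, inside the cell of that jump. So this cell carries a
  big increment, and distinct jump times lie in distinct cells.\<close>

lemma card_jumps_le:
  fixes h :: "nat \<Rightarrow> real" and K :: "nat \<Rightarrow> nat"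
  assumes w: "\<omega> \<in> space M" and \<tau>: "0 < \<tau>" and L: "0 < L"
    and h: "\<And>m. 0 < h m" "h \<longlonglongrightarrow> 0" and K: "\<And>m. 1 \<le> real (K m) * h m"
    and F: "finite F" "F \<subseteq> {0<..1}" "\<And>t. t \<in> F \<Longrightarrow> L \<le> jump (\<lambda>s. Y s \<omega>) t"
  shows "\<forall>\<^sub>F m in sequentially.
    card F \<le> card {k. k < K m \<and> big_increment L \<tau> (h m) (shift (real k * h m) \<omega>)}"
proof -
  \<comment> \<open>The index of the cell ]k h, (k+1) h] containing t. The cell is open on the left,
    so its left end precedes the jump even when t is a grid point.\<close>
  define k where "k m t = nat (\<lceil>t / h m\<rceil> - 1)" for m t
  have k: "real (k m t) * h m < t" "t \<le> real (k m t) * h m + h m" "k m t < K m" if "0 < t" "t \<le> 1" for m t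
  proof -
    have "0 < t / h m" using that h(1) by simp
    then have eq: "real (k m t) = of_int \<lceil>t / h m\<rceil> - 1"
      unfolding k_def by (subst of_nat_nat) linarith+
    then have "real (k m t) < t / h m" "t / h m \<le> real (k m t) + 1" by linarith+
    then show 1: "real (k m t) * h m < t" and "t \<le> real (k m t) * h m + h m"
      using h(1)[of m] by (simp_all add: field_simps)
    have "real (k m t) * h m < real (K m) * h m" using 1 K[of m] that by linarith
    then show "k m t < K m" using h(1)[of m] by simp
  qed
  have big: "\<forall>\<^sub>F m in sequentially. big_increment L \<tau> (h m) (shift (real (k m t) * h m) \<omega>)" if t: "t \<in> F" for t
  proof -
    have t01: "0 < t" "t \<le> 1" using F(2) t by auto
    obtain l where l: "((\<lambda>s. Y s \<omega>) \<longlongrightarrow> l) (at_left t)"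
      using paths[OF w] t01 by (auto simp: cadlag_def)
    have "Lim (at_left t) (\<lambda>s. Y s \<omega>) = l"
      using l by (intro tendsto_Lim) auto
    then have jmp: "L \<le> Y t \<omega> - l" using F(3)[OF t] by (simp add: jump_def)
    have "\<forall>\<^sub>F s in at_left t. dist (Y s \<omega>) l < \<tau> / 2"
      using l \<tau> by (intro tendstoD) auto
    then obtain a where a: "a < t" "\<And>s. a < s \<Longrightarrow> s < t \<Longrightarrow> \<bar>Y s \<omega> - l\<bar> < \<tau> / 2"
      by (auto simp: eventually_at_left_field dist_real_def)
    have "\<forall>\<^sub>F s in at_right t. dist (Y s \<omega>) (Y t \<omega>) < \<tau> / 2"
      using right_tendsto[OF w, of t] t01 \<tau> by (intro tendstoD) auto
    then obtain b where b: "t < b" "\<And>s. t < s \<Longrightarrow> s < b \<Longrightarrow> \<bar>Y s \<omega> - Y t \<omega>\<bar> < \<tau> / 2"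
      by (auto simp: eventually_at_right_field dist_real_def)
    have b': "\<bar>Y s \<omega> - Y t \<omega>\<bar> < \<tau> / 2" if "t \<le> s" "s < b" for s
      using b(2)[of s] that \<tau> by (cases "s = t") auto
    have "\<forall>\<^sub>F m in sequentially. h m < min (t - a) (b - t)"
      using a b by (intro order_tendstoD(2)[OF h(2)]) auto
    then show ?thesis
    proof eventually_elim
      case (elim m)
      let ?s = "real (k m t) * h m"
      have s: "0 \<le> ?s" "?s < t" "t \<le> ?s + h m" using k[OF t01, of m] h(1)[of m] by auto
      have before: "\<bar>Y v \<omega> - l\<bar> < \<tau> / 2" if "?s \<le> v" "v < t" for v
        using a(2)[of v] that elim s by auto
      have after: "\<bar>Y v \<omega> - Y t \<omega>\<bar> < \<tau> / 2" if "t \<le> v" "v \<le> ?s + h m" for v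
        using b'[of v] that elim s by auto
      have at_s: "\<bar>Y ?s \<omega> - l\<bar> < \<tau> / 2" using before[of ?s] s by simp
      have "\<bar>Y (?s + h m) \<omega> - Y t \<omega>\<bar> < \<tau> / 2" using after[of "?s + h m"] s by simp
      with at_s jmp have "L - \<tau> \<le> Y (?s + h m) \<omega> - Y ?s \<omega>" by linarith
      moreover have "- \<tau> \<le> Y (?s + u) \<omega> - Y ?s \<omega>" if u: "u \<in> {0..<h m}" for u
      proof (cases "?s + u < t")
        case True
        then have "\<bar>Y (?s + u) \<omega> - l\<bar> < \<tau> / 2" using before[of "?s + u"] u by simp
        with at_s show ?thesis by linarith
      next
        case False
        then have "\<bar>Y (?s + u) \<omega> - Y t \<omega>\<bar> < \<tau> / 2" using after[of "?s + u"] u by simp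
        with at_s jmp L show ?thesis by linarith
      qed
      ultimately show ?case
        using s(1) h(1)[of m] by (simp add: big_increment_shift_iff[OF w] less_imp_le)
    qed
  qed
  have inj: "\<forall>\<^sub>F m in sequentially. t \<noteq> t' \<longrightarrow> k m t \<noteq> k m t'" if "t \<in> F" "t' \<in> F" for t t'
  proof (cases "t = t'")
    case False
    then have "\<forall>\<^sub>F m in sequentially. h m < \<bar>t - t'\<bar>"
      by (intro order_tendstoD(2)[OF h(2)]) auto
    then show ?thesis
    proof eventually_elim
      case (elim m)
      have "0 < t" "t \<le> 1" "0 < t'" "t' \<le> 1" using that F(2) by auto
      from k[OF this(1,2), of m] k[OF this(3,4), of m] elim show ?case by auto
    qed
  qed auto
  have "\<forall>\<^sub>F m in sequentially. (\<forall>t\<in>F. big_increment L \<tau> (h m) (shift (real (k m t) * h m) \<omega>)) \<and>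
      (\<forall>t\<in>F. \<forall>t'\<in>F. t \<noteq> t' \<longrightarrow> k m t \<noteq> k m t')"
    using F(1) big inj by (intro eventually_conj eventually_ball_finite ballI) auto
  then show ?thesis
  proof eventually_elim
    case (elim m)
    have "card F = card (k m ` F)"
      using elim by (intro card_image[symmetric]) (auto simp: inj_on_def)
    also have "\<dots> \<le> card {k. k < K m \<and> big_increment L \<tau> (h m) (shift (real k * h m) \<omega>)}"
      using elim k(3) F(2) by (intro card_mono) auto
    finally show ?case .
  qed
qed

text \<open>Fatou's lemma bounds the expected number of large jumps by the expected number of large
  increments over a fine grid, so the jumps of the path never have to be enumerated measurably.\<close>

lemma levy_tail_le_liminf:
  fixes h :: "nat \<Rightarrow> real" and K :: "nat \<Rightarrow> nat"
  assumes \<pi>: "is_levy_measure M Y \<pi>" and \<tau>: "0 < \<tau>" and L: "0 < L"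
    and h: "\<And>m. 0 < h m" "h \<longlonglongrightarrow> 0" and K: "\<And>m. 1 \<le> real (K m) * h m"
  shows "levy_tail \<pi> L \<le>
    liminf (\<lambda>m. ennreal (real (K m) * prob {\<omega> \<in> space M. big_increment L \<tau> (h m) (shift 0 \<omega>)}))"
proof -
  let ?J = "\<lambda>\<omega>. {t \<in> {0<..1}. jump (\<lambda>s. Y s \<omega>) t \<in> {L..} - {0}}"
  let ?B = "\<lambda>m k. {\<omega> \<in> space M. big_increment L \<tau> (h m) (shift (real k * h m) \<omega>)}"
  have pred: "Measurable.pred path_space (big_increment L \<tau> (h m))" for m
    using h(1)[of m] by (intro measurable_big_increment) auto
  have [measurable]: "?B m k \<in> events" for m k
  proof -
    have "0 \<le> real k * h m" using h(1)[of m] by simp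
    from measurable_compose[OF measurable_shift[OF this] pred[of m]] show ?thesis by (simp add: pred_def)
  qed
  define N where "N m \<omega> = (\<Sum>k<K m. indicator (?B m k) \<omega> :: ennreal)" for m \<omega>
  have N: "N m \<omega> = of_nat (card {k. k < K m \<and> big_increment L \<tau> (h m) (shift (real k * h m) \<omega>)})"
    if "\<omega> \<in> space M" for m \<omega>
    using that by (simp add: N_def indicator_def sum.If_cases Int_def lessThan_def)
  have int: "(\<integral>\<^sup>+ \<omega>. N m \<omega> \<partial>M) =
      ennreal (real (K m) * prob {\<omega> \<in> space M. big_increment L \<tau> (h m) (shift 0 \<omega>)})" for m
  proof -
    have "(\<integral>\<^sup>+ \<omega>. N m \<omega> \<partial>M) = (\<Sum>k<K m. emeasure M (?B m k))"
      unfolding N_def by (simp add: nn_integral_sum)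
    also have "\<dots> = (\<Sum>k<K m. ennreal (prob {\<omega> \<in> space M. big_increment L \<tau> (h m) (shift 0 \<omega>)}))"
    proof (rule sum.cong[OF refl])
      fix k
      have "0 \<le> real k * h m" using h(1)[of m] by simp
      from prob_shift[OF this pred]
      show "emeasure M (?B m k) = ennreal (prob {\<omega> \<in> space M. big_increment L \<tau> (h m) (shift 0 \<omega>)})"
        by (simp add: emeasure_eq_measure)
    qed
    finally show ?thesis by (simp add: ennreal_mult ennreal_of_nat_eq_real_of_nat)
  qed
  have "levy_tail \<pi> L = (\<integral>\<^sup>+ \<omega>. emeasure (count_space UNIV) (?J \<omega>) \<partial>M)"
    using \<pi> by (simp add: levy_tail_def is_levy_measure_def)
  also have "\<dots> \<le> (\<integral>\<^sup>+ \<omega>. liminf (\<lambda>m. N m \<omega>) \<partial>M)"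
  proof (rule nn_integral_mono)
    fix \<omega> assume w: "\<omega> \<in> space M"
    \<comment> \<open>Whether a path has finitely many jumps of size at least L is left open: the
      bound is shown for each finite subset, and an infinite set forces the lower limit to be
      infinite.\<close>
    have card: "of_nat (card F) \<le> liminf (\<lambda>m. N m \<omega>)" if "finite F" "F \<subseteq> ?J \<omega>" for F
    proof (rule Liminf_bounded)
      have "\<forall>\<^sub>F m in sequentially.
          card F \<le> card {k. k < K m \<and> big_increment L \<tau> (h m) (shift (real k * h m) \<omega>)}"
        using that by (intro card_jumps_le[OF w \<tau> L h K]) auto
      then show "\<forall>\<^sub>F m in sequentially. of_nat (card F) \<le> N m \<omega>"
        by eventually_elim (simp add: N[OF w])
    qed
    show "emeasure (count_space UNIV) (?J \<omega>) \<le> liminf (\<lambda>m. N m \<omega>)"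
    proof (cases "finite (?J \<omega>)")
      case True
      then show ?thesis using card[OF True] by (simp add: emeasure_count_space)
    next
      case False
      have "of_nat n \<le> liminf (\<lambda>m. N m \<omega>)" for n
        using card infinite_arbitrarily_large[OF False, of n] by auto
      then have "liminf (\<lambda>m. N m \<omega>) = \<top>"
        using ennreal_Ex_less_of_nat not_less top.not_eq_extremum by metis
      then show ?thesis by simp
    qed
  qed
  also have "\<dots> \<le> liminf (\<lambda>m. \<integral>\<^sup>+ \<omega>. N m \<omega> \<partial>M)"
    unfolding N_def by (intro nn_integral_liminf) measurable
  also have "\<dots> = liminf (\<lambda>m. ennreal (real (K m) * prob {\<omega> \<in> space M. big_increment L \<tau> (h m) (shift 0 \<omega>)}))"
    by (simp only: int)
  finally show ?thesis .
qed

text \<open>The event \<open>E k\<close> says that the path stays within \<tau> of 0 up to k h, has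
  a big increment over the next cell, and afterwards never falls more than \<tau> below the level
  reached. These events are disjoint and contained in the event of \<open>jump_prob\<close>, and
  each has at least a quarter of the probability of one big increment.\<close>

lemma prob_first_big_increment:
  assumes \<tau>: "0 < \<tau>" and L: "3 * \<tau> < L" and h: "0 < h" and \<delta>: "real m * h \<le> \<delta>"
    and half: "1 / 2 \<le> prob {\<omega> \<in> space M. \<forall>u\<in>{0..<\<delta>}. Y u \<omega> \<in> {- \<tau>..\<tau>}}"
  shows "real m * prob {\<omega> \<in> space M. big_increment L \<tau> h (shift 0 \<omega>)} \<le>
    4 * jump_prob (L - 3 * \<tau>) (3 * \<tau>) (real m * h)"
proof -
  let ?d = "real m * h"
  \<comment> \<open>The path restarted at time h, so that \<open>?S (shift s \<omega>)\<close> is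
    \<open>shift (s + h) \<omega>\<close>.\<close>
  let ?S = "\<lambda>f. \<lambda>u\<in>{0..}. f (h + u) - f h :: real"
  define Q where "Q k f \<longleftrightarrow> f (real k * h) \<in> {- \<tau>..\<tau>} \<and> stays_in {- \<tau>..\<tau>} (real k * h) f" for k :: nat and f
  \<comment> \<open>The last stretch has length m h for every k, more than the time that remains, so
    that R does not depend on k.\<close>
  define R where "R f \<longleftrightarrow> big_increment L \<tau> h f \<and> stays_in {- \<tau>..} ?d (?S f)" for f
  define E where "E k = {\<omega> \<in> space M. Q k (past (real k * h) \<omega>) \<and> R (shift (real k * h) \<omega>)}" for k
  have kh: "0 \<le> real k * h" for k using h by simp
  have d0: "0 \<le> ?d" using h by simp
  have predQ: "Measurable.pred (\<Pi>\<^sub>M t\<in>{0..real k * h}. borel) (Q k)" for k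
  proof -
    have [measurable]: "(\<lambda>f. f (real k * h)) \<in> borel_measurable (\<Pi>\<^sub>M t\<in>{0..real k * h}. borel)"
      using kh by (intro measurable_component_singleton) auto
    have [measurable]: "Measurable.pred (\<Pi>\<^sub>M t\<in>{0..real k * h}. borel) (stays_in {- \<tau>..\<tau>} (real k * h))"
      by (intro measurable_stays_in) auto
    show ?thesis unfolding Q_def[abs_def] by measurable
  qed
  have pred_stay: "Measurable.pred path_space (stays_in {- \<tau>..} ?d)"
    by (intro measurable_stays_in) auto
  have [measurable]: "?S \<in> measurable path_space path_space"
    using h by (intro measurable_restrict borel_measurable_diff measurable_component_singleton) auto
  have predB: "Measurable.pred path_space (big_increment L \<tau> h)"
    using h by (intro measurable_big_increment) auto
  have predR: "Measurable.pred path_space R"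
    unfolding R_def[abs_def]
    using predB measurable_compose[OF _ pred_stay, of ?S path_space] by (intro pred_intros_logic) auto
  have S_shift: "?S (shift s \<omega>) = shift (s + h) \<omega>" if "0 \<le> s" for s \<omega>
    using h by (auto simp: shift_def fun_eq_iff add.assoc)
  have R_iff: "R (shift s \<omega>) \<longleftrightarrow> L - \<tau> \<le> Y (s + h) \<omega> - Y s \<omega> \<and>
      (\<forall>u\<in>{0..<h}. - \<tau> \<le> Y (s + u) \<omega> - Y s \<omega>) \<and>
      (\<forall>u\<in>{0..<?d}. - \<tau> \<le> Y (s + h + u) \<omega> - Y (s + h) \<omega>)"
    if "\<omega> \<in> space M" "0 \<le> s" for s \<omega>
    using that h unfolding R_def S_shift[OF that(2)]
    by (simp add: big_increment_shift_iff stays_in_shift_iff)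
  have E_sets: "E k \<in> events" for k
  proof -
    have "{\<omega> \<in> space M. Q k (past (real k * h) \<omega>)} \<in> events"
      using measurable_compose[OF measurable_past predQ] by (simp add: pred_def)
    moreover have "{\<omega> \<in> space M. R (shift (real k * h) \<omega>)} \<in> events"
      using measurable_compose[OF measurable_shift[OF kh] predR] by (simp add: pred_def)
    ultimately show ?thesis unfolding E_def by (intro sets.sets_Collect_conj)
  qed
  have E_facts: "\<bar>Y u \<omega>\<bar> \<le> \<tau>" if "0 \<le> u" "u \<le> real k * h" "\<omega> \<in> E k" for u k \<omega>
  proof -
    have w: "\<omega> \<in> space M" "Q k (past (real k * h) \<omega>)" using that by (auto simp: E_def)
    then have "Y (real k * h) \<omega> \<in> {- \<tau>..\<tau>}" "\<forall>u\<in>{0..<real k * h}. Y u \<omega> \<in> {- \<tau>..\<tau>}"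
      using kh[of k] by (auto simp: Q_def past_apply stays_in_past_iff)
    then have "Y u \<omega> \<in> {- \<tau>..\<tau>}" using that(1,2) by (cases "u = real k * h") auto
    then show ?thesis by auto
  qed
  have E_R: "\<omega> \<in> space M" "R (shift (real k * h) \<omega>)" if "\<omega> \<in> E k" for \<omega> k
    using that by (auto simp: E_def)
  have jumped: "L - 2 * \<tau> \<le> Y (real k * h + h) \<omega>" if "\<omega> \<in> E k" for \<omega> k
    using E_facts[OF kh order_refl that] E_R(2)[OF that] R_iff[OF E_R(1)[OF that] kh[of k]]
    by auto
  \<comment> \<open>After the big increment the level is at least L - 2 \<tau>, which exceeds
    \<tau>, whereas a later event still requires the path to be within \<tau> of 0 at that
    time.\<close>
  have disj: "disjoint_family_on E {..<m}"
  proof -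
    have "E k \<inter> E j = {}" if "k < j" for k j
    proof -
      have "real (Suc k) * h \<le> real j * h" using that h by (intro mult_right_mono) auto
      then have le: "real k * h + h \<le> real j * h" by (simp add: algebra_simps)
      have "False" if "\<omega> \<in> E k" "\<omega> \<in> E j" for \<omega>
        using jumped[OF that(1)] E_facts[OF _ le that(2)] kh[of k] h L by auto
      then show ?thesis by auto
    qed
    then show ?thesis unfolding disjoint_family_on_def by (metis Int_commute linorder_neqE_nat)
  qed
  have "prob (\<Union>k<m. E k) \<le> jump_prob (L - 3 * \<tau>) (3 * \<tau>) ?d"
    unfolding jump_prob_def
  proof (rule finite_measure_mono[OF _ sets_jump_prob[OF d0]], rule subsetI)
    fix \<omega> assume "\<omega> \<in> (\<Union>k<m. E k)"
    then obtain k where k: "k < m" "\<omega> \<in> E k" by auto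
    note w = E_R(1)[OF k(2)]
    note R = E_R(2)[OF k(2), unfolded R_iff[OF w kh]]
    have "real (Suc k) * h \<le> ?d" using k(1) h by (intro mult_right_mono) auto
    then have le: "real k * h + h \<le> ?d" by (simp add: algebra_simps)
    have late: "L - 3 * \<tau> \<le> Y u \<omega>" if "real k * h + h \<le> u" "u \<le> ?d" for u
    proof -
      have "u - (real k * h + h) \<in> {0..<?d}"
        unfolding atLeastLessThan_iff using that kh[of k] h by linarith
      with R have "- \<tau> \<le> Y (real k * h + h + (u - (real k * h + h))) \<omega> - Y (real k * h + h) \<omega>" by blast
      then show ?thesis using jumped[OF k(2)] by simp
    qed
    \<comment> \<open>The floors are -\<tau> before the cell, -2 \<tau> inside it and L - 3 \<tau> >
      0 after it.\<close>
    have "- (3 * \<tau>) \<le> Y u \<omega>" if "u \<in> {0..<?d}" for u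
    proof -
      consider "u \<le> real k * h" | "real k * h \<le> u" "u < real k * h + h" | "real k * h + h \<le> u" by linarith
      then show ?thesis
      proof cases
        case 1
        then show ?thesis using E_facts[OF _ 1 k(2)] that \<tau> by auto
      next
        case 2
        then have "u - real k * h \<in> {0..<h}" by auto
        with R have "- \<tau> \<le> Y (real k * h + (u - real k * h)) \<omega> - Y (real k * h) \<omega>" by blast
        then show ?thesis using E_facts[OF kh order_refl k(2)] \<tau> by auto
      next
        case 3
        then show ?thesis using late[OF 3] that \<tau> L by auto
      qed
    qed
    then show "\<omega> \<in> {\<omega> \<in> space M. L - 3 * \<tau> \<le> Y ?d \<omega> \<and> (\<forall>u\<in>{0..<?d}. - (3 * \<tau>) \<le> Y u \<omega>)}"
      using late[OF le order_refl] w by auto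
  qed
  moreover have "prob (\<Union>k<m. E k) = (\<Sum>k<m. prob (E k))"
    using E_sets disj by (intro finite_measure_finite_Union) auto
  \<comment> \<open>Independence is used at both ends of the cell. The stretches before and after it
    last at most m h \<le> \<delta>, so each stays in bounds with probability at least 1/2.\<close>
  moreover have "prob {\<omega> \<in> space M. big_increment L \<tau> h (shift 0 \<omega>)} / 4 \<le> prob (E k)" if "k < m" for k
  proof -
    let ?p = "prob {\<omega> \<in> space M. big_increment L \<tau> h (shift 0 \<omega>)}"
    have past: "{\<omega> \<in> space M. Q k (past (real k * h) \<omega>)} =
        {\<omega> \<in> space M. Y (real k * h) \<omega> \<in> {- \<tau>..\<tau>} \<and> (\<forall>u\<in>{0..<real k * h}. Y u \<omega> \<in> {- \<tau>..\<tau>})}"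
      using kh[of k] by (auto simp: Q_def past_apply stays_in_past_iff)
    have "real k * h < real m * h" using that h by simp
    then have "1 / 2 \<le> prob {\<omega> \<in> space M. Q k (past (real k * h) \<omega>)}"
      using \<delta> kh[of k] measurable_compose[OF measurable_past predQ[of k]]
      by (intro order_trans[OF half] finite_measure_mono) (auto simp: past pred_def)
    moreover have "?p / 2 \<le> prob {\<omega> \<in> space M. R (shift 0 \<omega>)}"
    proof -
      have predB': "Measurable.pred (\<Pi>\<^sub>M t\<in>{0..h}. borel) (big_increment L \<tau> h)"
        using h by (intro measurable_big_increment) auto
      have pastB: "big_increment L \<tau> h (past h \<omega>) \<longleftrightarrow> big_increment L \<tau> h (shift 0 \<omega>)" if "\<omega> \<in> space M" for \<omega>
        using that h unfolding big_increment_def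
        by (simp add: past_apply shift_apply stays_in_past_iff stays_in_shift_iff start)
      have "prob {\<omega> \<in> space M. R (shift 0 \<omega>)} =
          prob {\<omega> \<in> space M. big_increment L \<tau> h (past h \<omega>) \<and> stays_in {- \<tau>..} ?d (shift h \<omega>)}"
        using S_shift[of 0] by (intro arg_cong[where f=prob] Collect_cong) (auto simp: R_def pastB)
      also have "\<dots> = prob {\<omega> \<in> space M. big_increment L \<tau> h (past h \<omega>)} *
          prob {\<omega> \<in> space M. stays_in {- \<tau>..} ?d (shift 0 \<omega>)}"
        using h by (intro prob_past_shift predB' pred_stay) auto
      also have "{\<omega> \<in> space M. big_increment L \<tau> h (past h \<omega>)} = {\<omega> \<in> space M. big_increment L \<tau> h (shift 0 \<omega>)}"
        using pastB by auto
      finally have eq: "prob {\<omega> \<in> space M. R (shift 0 \<omega>)} = ?p * prob {\<omega> \<in> space M. stays_in {- \<tau>..} ?d (shift 0 \<omega>)}" .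
      have "1 / 2 \<le> prob {\<omega> \<in> space M. stays_in {- \<tau>..} ?d (shift 0 \<omega>)}"
        using \<delta> measurable_compose[OF measurable_shift[OF order_refl] pred_stay]
        by (intro order_trans[OF half] finite_measure_mono) (auto simp: pred_def stays_in_shift_iff start)
      then show ?thesis using mult_left_mono[of "1/2" _ ?p] by (simp add: eq)
    qed
    ultimately have "1 / 2 * (?p / 2) \<le> prob {\<omega> \<in> space M. Q k (past (real k * h) \<omega>)} * prob {\<omega> \<in> space M. R (shift 0 \<omega>)}"
      by (intro mult_mono) auto
    also have "\<dots> = prob (E k)"
      unfolding E_def using prob_past_shift[OF kh predQ predR] by simp
    finally show ?thesis by simp
  qed
  then have "(\<Sum>k<m. prob {\<omega> \<in> space M. big_increment L \<tau> h (shift 0 \<omega>)} / 4) \<le> (\<Sum>k<m. prob (E k))"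
    by (intro sum_mono) auto
  ultimately show ?thesis by simp
qed

text \<open>The threshold \<open>\<delta>\<^sub>0\<close> is chosen before L. This order of
  quantifiers matters for (1), where L tends to infinity as \<delta> tends to 0.\<close>

lemma jump_prob_ge_levy_tail:
  assumes \<pi>: "is_levy_measure M Y \<pi>" and \<tau>: "0 < \<tau>"
  obtains \<delta>\<^sub>0 where "0 < \<delta>\<^sub>0"
    "\<forall>\<delta>\<in>{0<..\<delta>\<^sub>0}. \<forall>L>3 * \<tau>.
      ennreal \<delta> * levy_tail \<pi> L \<le> ennreal (8 * jump_prob (L - 3 * \<tau>) (3 * \<tau>) \<delta>)"
proof -
  obtain \<delta>\<^sub>0 where \<delta>\<^sub>0: "0 < \<delta>\<^sub>0" "prob {\<omega> \<in> space M. \<forall>u\<in>{0..<\<delta>\<^sub>0}. Y u \<omega> \<in> {- \<tau>..\<tau>}} \<ge> 1 / 2"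
    using small_time[OF \<tau>] .
  show ?thesis
  \<comment> \<open>Since \<delta> \<le> 1, the quotient (m+1)/\<delta> is at least 1 and rounding
    it up at most doubles it. This 2 times the 4 of \<open>prob_first_big_increment\<close> is the
    constant 8.\<close>
  proof (rule that[of "min \<delta>\<^sub>0 1"]; (intro ballI allI impI)?)
    fix \<delta> L assume "\<delta> \<in> {0<..min \<delta>\<^sub>0 1}" and L: "3 * \<tau> < L"
    then have \<delta>: "0 < \<delta>" "\<delta> \<le> min \<delta>\<^sub>0 1" by auto
    let ?q = "jump_prob (L - 3 * \<tau>) (3 * \<tau>) \<delta>"
    \<comment> \<open>The interval up to \<delta> is cut into m+1 cells of length
      \<open>h m\<close>, and \<open>K m\<close> such cells cover the unit of time in which
      \<open>is_levy_measure\<close> counts jumps.\<close>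
    define h where "h m = \<delta> / real (Suc m)" for m
    define K where "K m = nat \<lceil>real (Suc m) / \<delta>\<rceil>" for m
    have h: "0 < h m" "h \<longlonglongrightarrow> 0" for m
    proof -
      show "0 < h m" using \<delta> by (simp add: h_def)
      have "(\<lambda>m. \<delta> * inverse (real (Suc m))) \<longlonglongrightarrow> \<delta> * 0"
        by (intro tendsto_intros LIMSEQ_inverse_real_of_nat)
      then show "h \<longlonglongrightarrow> 0" by (simp add: h_def[abs_def] divide_inverse)
    qed
    have ge: "real (Suc m) / \<delta> \<le> real (K m)" for m
      unfolding K_def by (rule real_nat_ceiling_ge)
    have K: "1 \<le> real (K m) * h m" for m
      using mult_right_mono[OF ge[of m], of "h m"] h(1)[of m] \<delta> by (simp add: h_def)
    have Kle: "real (K m) \<le> 2 / \<delta> * real (Suc m)" for m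
    proof -
      have "1 \<le> real (Suc m) / \<delta>" using \<delta> by (simp add: field_simps)
      moreover have "0 \<le> real (Suc m) / \<delta>" using \<delta> by simp
      then have "real (K m) \<le> real (Suc m) / \<delta> + 1"
        unfolding K_def by linarith
      ultimately have "real (K m) \<le> 2 * (real (Suc m) / \<delta>)" by linarith
      then show ?thesis by simp
    qed
    have "levy_tail \<pi> L \<le>
        liminf (\<lambda>m. ennreal (real (K m) * prob {\<omega> \<in> space M. big_increment L \<tau> (h m) (shift 0 \<omega>)}))"
      using L \<tau> by (intro levy_tail_le_liminf[OF \<pi> \<tau> _ h K]) auto
    also have "\<dots> \<le> liminf (\<lambda>m::nat. ennreal (8 / \<delta> * ?q))"
    proof (intro Liminf_mono always_eventually allI ennreal_leI)
      fix m
      let ?p = "prob {\<omega> \<in> space M. big_increment L \<tau> (h m) (shift 0 \<omega>)}"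
      have eq: "real (Suc m) * h m = \<delta>" by (simp add: h_def)
      have "real (Suc m) * ?p \<le> 4 * ?q"
        using prob_first_big_increment[OF \<tau> L h(1), of "Suc m" m \<delta>\<^sub>0] \<delta>\<^sub>0(2) \<delta> unfolding eq by simp
      then have le: "2 / \<delta> * (real (Suc m) * ?p) \<le> 2 / \<delta> * (4 * ?q)"
        using \<delta> by (intro mult_left_mono) auto
      have "real (K m) * ?p \<le> 2 / \<delta> * real (Suc m) * ?p"
        using Kle by (intro mult_right_mono) auto
      also have "\<dots> = 2 / \<delta> * (real (Suc m) * ?p)" by (simp only: mult.assoc)
      also note le
      finally show "real (K m) * ?p \<le> 8 / \<delta> * ?q" by simp
    qed
    also have "\<dots> = ennreal (8 / \<delta> * ?q)" by (simp add: Liminf_const)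
    finally have "ennreal \<delta> * levy_tail \<pi> L \<le> ennreal \<delta> * ennreal (8 / \<delta> * ?q)"
      by (rule mult_left_mono) simp
    also have "\<dots> = ennreal (8 * ?q)"
      using \<delta> by (subst ennreal_mult[symmetric]) (auto simp: jump_prob_def)
    finally show "ennreal \<delta> * levy_tail \<pi> L \<le> ennreal (8 * ?q)" .
  qed (use \<delta>\<^sub>0 in auto)
qed

end

section \<open>Finiteness of the exponential functional\<close>

text \<open>One-sided limits make the path locally bounded, and the interval is compact.\<close>

lemma cadlag_bounded:
  assumes f: "cadlag f"
  obtains b where "\<And>t. t \<in> {0..T} \<Longrightarrow> \<bar>f t\<bar> \<le> b"
proof (cases "0 \<le> T")
  case True
  \<comment> \<open>The intersection with the half-line is there for the local step at 0, whose
    neighbourhoods reach negative times where f is arbitrary.\<close>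
  have "\<exists>b. \<forall>t\<in>{0..T} \<inter> {0..}. \<bar>f t\<bar> \<le> b"
    using True
  proof (induction rule: Bolzano[where P="\<lambda>a b. \<exists>c. \<forall>t\<in>{a..b} \<inter> {0..}. \<bar>f t\<bar> \<le> c"])
    case (trans a b c)
    then obtain b1 b2 where b12: "\<forall>t\<in>{a..b} \<inter> {0..}. \<bar>f t\<bar> \<le> b1" "\<forall>t\<in>{b..c} \<inter> {0..}. \<bar>f t\<bar> \<le> b2"
      by blast
    have "\<bar>f t\<bar> \<le> max b1 b2" if "t \<in> {a..c} \<inter> {0..}" for t
      using that b12 by (cases "t \<le> b") (force simp: le_max_iff_disj)+
    then show ?case by blast
  next
    case (local x)
    have "\<forall>\<^sub>F s in at_right x. dist (f s) (f x) < 1"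
      using cadlag_right_tendsto[OF f local(1)] by (rule tendstoD) simp
    then obtain r where r: "x < r" "\<And>s. x < s \<Longrightarrow> s < r \<Longrightarrow> \<bar>f s - f x\<bar> < 1"
      by (auto simp: eventually_at_right_field dist_real_def)
    obtain l a where l: "a < x" "\<And>s. 0 \<le> s \<Longrightarrow> a < s \<Longrightarrow> s < x \<Longrightarrow> \<bar>f s - l\<bar> < 1"
    proof (cases "x = 0")
      case True
      then show ?thesis by (intro that[of "-1"]) auto
    next
      case False
      then have "0 < x" using local(1) by simp
      then obtain l where "(f \<longlongrightarrow> l) (at_left x)" using f unfolding cadlag_def by blast
      then have "\<forall>\<^sub>F s in at_left x. dist (f s) l < 1" by (rule tendstoD) simp
      then show ?thesis using that by (auto simp: eventually_at_left_field dist_real_def)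
    qed
    have "\<exists>c. \<forall>t\<in>{u..v} \<inter> {0..}. \<bar>f t\<bar> \<le> c"
      if uv: "u \<le> x \<and> x \<le> v \<and> v - u < min (x - a) (r - x)" for u v
    proof (intro exI ballI)
      fix t assume t: "t \<in> {u..v} \<inter> {0..}"
      consider "t = x" | "x < t" | "t < x" by linarith
      then show "\<bar>f t\<bar> \<le> \<bar>f x\<bar> + \<bar>l\<bar> + 1"
      proof cases
        case 2
        then have "\<bar>f t - f x\<bar> < 1" using t uv by (intro r(2)) auto
        then show ?thesis by linarith
      next
        case 3
        then have "\<bar>f t - l\<bar> < 1" using t uv by (intro l(2)) auto
        then show ?thesis by linarith
      qed simp
    qed
    then show ?case using r(1) l(1) by (intro exI[of _ "min (x - a) (r - x)"]) auto
  qed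
  then obtain b where "\<forall>t\<in>{0..T} \<inter> {0..}. \<bar>f t\<bar> \<le> b" ..
  then show ?thesis by (intro that[of b]) auto
qed (use that in auto)

lemma borel_measurable_indicator_section:
  assumes "Measurable.pred (A \<Otimes>\<^sub>M B) (\<lambda>x. P (fst x) (snd x))"
  shows "(\<lambda>(t, \<omega>). indicator {t. P t \<omega>} t :: ennreal) \<in> borel_measurable (A \<Otimes>\<^sub>M B)"
proof -
  have "(\<lambda>x. indicator {x \<in> space (A \<Otimes>\<^sub>M B). P (fst x) (snd x)} x :: ennreal) \<in> borel_measurable (A \<Otimes>\<^sub>M B)"
    using assms by (intro borel_measurable_indicator) (simp add: pred_def)
  then show ?thesis
    by (rule measurable_cong[THEN iffD1, rotated]) (auto simp: indicator_def split: prod.splits)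
qed

context levy_process
begin

lemma measurable_joint:
  "(\<lambda>(t, \<omega>). right_eval (t + s) (shift 0 \<omega>)) \<in> borel_measurable (lborel \<Otimes>\<^sub>M M)"
proof -
  have "(\<lambda>x. fst x + s) \<in> borel_measurable (lborel \<Otimes>\<^sub>M M)" by measurable
  moreover have "(\<lambda>x. shift 0 (snd x)) \<in> measurable (lborel \<Otimes>\<^sub>M M) path_space" by measurable
  ultimately have "(\<lambda>x. right_eval (fst x + s) (shift 0 (snd x))) \<in> borel_measurable (lborel \<Otimes>\<^sub>M M)"
    by (rule measurable_Pair_compose_split[OF measurable_right_eval])
  then show ?thesis by (simp add: case_prod_beta)
qed

text \<open>The half-line of times is exhausted by bounded intervals so that
  \<open>stays_in\<close>, and with it countability, applies.\<close>

definition stays_above_after :: "real \<Rightarrow> (real \<Rightarrow> real) \<Rightarrow> bool" where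
  "stays_above_after m f \<longleftrightarrow> (\<forall>n::nat. stays_in {1..} (real n) (\<lambda>u. f (m + u)))"

lemma stays_above_after_shift_iff:
  assumes w: "\<omega> \<in> space M" and t: "0 \<le> t" and m: "0 \<le> m"
  shows "stays_above_after m (shift t \<omega>) \<longleftrightarrow> (\<forall>u\<ge>m. 1 \<le> Y (t + u) \<omega> - Y t \<omega>)"
proof -
  let ?g = "\<lambda>u. Y (t + m + u) \<omega> - Y t \<omega>"
  have "stays_above_after m (shift t \<omega>) \<longleftrightarrow> (\<forall>n::nat. stays_in {1..} (real n) ?g)"
    unfolding stays_above_after_def using m
    by (intro all_cong1 stays_in_cong) (simp add: shift_apply add.assoc)
  also have "\<dots> \<longleftrightarrow> (\<forall>n::nat. \<forall>u\<in>{0..<real n}. ?g u \<in> {1..})"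
  proof (intro all_cong1 stays_in_iff)
    fix u :: real assume u: "0 \<le> u"
    have "filterlim (\<lambda>v. t + m + v) (at_right (t + m + u)) (at_right u)"
      unfolding filterlim_at
      by (intro conjI tendsto_intros eventually_mono[OF eventually_at_right_less[of u]]) auto
    then show "(?g \<longlongrightarrow> ?g u) (at_right u)"
      using t m u by (intro tendsto_intros filterlim_compose[OF right_tendsto[OF w]]) auto
  qed simp
  also have "\<dots> \<longleftrightarrow> (\<forall>u\<ge>m. 1 \<le> Y (t + u) \<omega> - Y t \<omega>)"
  proof (intro iffI allI ballI impI)
    fix u assume *: "\<forall>n::nat. \<forall>u\<in>{0..<real n}. ?g u \<in> {1..}" and u: "m \<le> u"
    obtain n :: nat where "u - m < real n" using reals_Archimedean2 by blast
    then have "u - m \<in> {0..<real n}" using u by simp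
    with * have "?g (u - m) \<in> {1..}" by blast
    then show "1 \<le> Y (t + u) \<omega> - Y t \<omega>" by (simp add: algebra_simps)
  next
    fix n :: nat and u assume *: "\<forall>u\<ge>m. 1 \<le> Y (t + u) \<omega> - Y t \<omega>" and "u \<in> {0..<real n}"
    then have "1 \<le> Y (t + (m + u)) \<omega> - Y t \<omega>" by auto
    then show "?g u \<in> {1..}" by (simp add: add.assoc)
  qed
  finally show ?thesis .
qed

lemma measurable_stays_above_after:
  assumes "0 \<le> m"
  shows "Measurable.pred path_space (stays_above_after m)"
  unfolding stays_above_after_def[abs_def] stays_in_def
proof (intro pred_intros_countable(1) measurable_pred_countable(1))
  show "countable (\<rat> \<inter> {0..<real n})" for n
    using countable_rat by (rule countable_subset[rotated]) auto
  fix n :: nat and q :: real assume "q \<in> \<rat> \<inter> {0..<real n}"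
  then have [measurable]: "(\<lambda>f. f (m + q)) \<in> borel_measurable path_space"
    using assms by (intro measurable_component_singleton) auto
  show "Measurable.pred path_space (\<lambda>f. f (m + q) \<in> {1..})" by measurable
qed

text \<open>Almost every path is eventually at least 1, so the events for integer m cover almost the
  whole space and one of them has positive probability.\<close>

lemma stays_above_after_pos:
  assumes "drifts_to_infinity M Y"
  obtains m :: real where "0 \<le> m" "0 < prob {\<omega> \<in> space M. stays_above_after m (shift 0 \<omega>)}"
proof (rule ccontr)
  assume "\<not> thesis"
  let ?A = "\<lambda>n::nat. {\<omega> \<in> space M. stays_above_after (real n) (shift 0 \<omega>)}"
  have sets: "?A n \<in> events" for n
    using measurable_compose[OF measurable_shift[OF order_refl] measurable_stays_above_after[of "real n"]]
    by (simp add: pred_def)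
  have "prob (?A n) = 0" for n
    using \<open>\<not> thesis\<close> that[of "real n"] measure_nonneg[of M "?A n"] by (cases "prob (?A n) = 0") auto
  then have "AE \<omega> in M. \<not> stays_above_after (real n) (shift 0 \<omega>)" for n
    using sets[of n] by (subst AE_iff_measurable[OF sets[of n]]) (auto simp: emeasure_eq_measure)
  then have "AE \<omega> in M. \<forall>n::nat. \<not> stays_above_after (real n) (shift 0 \<omega>)"
    by (simp add: AE_all_countable)
  then have "AE \<omega> in M. False"
    using assms[unfolded drifts_to_infinity_def] AE_space
  proof eventually_elim
    case (elim \<omega>)
    then have "\<forall>\<^sub>F t in at_top. 1 \<le> Y t \<omega>" by (simp add: filterlim_at_top)
    then obtain T where T: "\<And>t. T \<le> t \<Longrightarrow> 1 \<le> Y t \<omega>" by (auto simp: eventually_at_top_linorder)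
    obtain n :: nat where "T \<le> real n" using real_arch_simple by blast
    then have "stays_above_after (real n) (shift 0 \<omega>)"
      using T elim(3) by (simp add: stays_above_after_shift_iff start)
    then show False using elim(1) by blast
  qed
  then show False by simp
qed

text \<open>Transience: since after a time \<open>m\<close> the path has a fixed chance \<open>q\<close> of never returning
  within distance 1, the expected time spent in any interval of length 1 is at most \<open>m / q\<close>.\<close>

lemma occupation_time_le:
  assumes m: "0 \<le> m" and q: "0 < q" "q = prob {\<omega> \<in> space M. stays_above_after m (shift 0 \<omega>)}"
  shows "(\<integral>\<^sup>+ \<omega>. (\<integral>\<^sup>+ t. indicator {t. 0 \<le> t \<and> right_eval t (shift 0 \<omega>) \<in> {a..<a + 1}} t \<partial>lborel) \<partial>M)
    \<le> ennreal (m / q)" (is "?I \<le> _")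
proof -
  interpret L: pair_sigma_finite lborel M ..
  let ?y = "\<lambda>t \<omega>. right_eval t (shift 0 \<omega>)"
  \<comment> \<open>The event \<open>stays_above_after m (shift t \<omega>)\<close>, spelled out
    with \<open>right_eval\<close> to be jointly measurable in t and \<omega> for Fubini.\<close>
  let ?S = "\<lambda>t \<omega>. \<forall>n::nat. \<forall>r\<in>\<rat> \<inter> {0..<real n}. 1 \<le> right_eval (t + (m + r)) (shift 0 \<omega>) - ?y t \<omega>"
  let ?G = "\<lambda>t \<omega>. 0 \<le> t \<and> ?y t \<omega> \<in> {a..<a + 1}"
  have y: "?y t \<omega> = Y t \<omega>" if "0 \<le> t" "\<omega> \<in> space M" for t \<omega>
    using that by (simp add: right_eval_shift start)
  have S: "?S t \<omega> \<longleftrightarrow> stays_above_after m (shift t \<omega>)" if "0 \<le> t" "\<omega> \<in> space M" for t \<omega>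
    using that m unfolding stays_above_after_def stays_in_def
    by (intro all_cong1 ball_cong) (auto simp: y shift_apply)
  note meas = measurable_joint[of 0, simplified] measurable_joint
  have [measurable]: "(\<lambda>x. right_eval (fst x) (shift 0 (snd x))) \<in> borel_measurable (lborel \<Otimes>\<^sub>M M)"
    using meas(1) by (simp add: case_prod_beta)
  have joint: "(\<lambda>x. right_eval (fst x + s) (shift 0 (snd x))) \<in> borel_measurable (lborel \<Otimes>\<^sub>M M)" for s
    using meas(2)[of s] by (simp add: case_prod_beta)
  have G: "Measurable.pred (lborel \<Otimes>\<^sub>M M) (\<lambda>x. ?G (fst x) (snd x))"
    by measurable
  have SS: "Measurable.pred (lborel \<Otimes>\<^sub>M M) (\<lambda>x. ?S (fst x) (snd x))"
  proof (intro pred_intros_countable(1) measurable_pred_countable(1))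
    show "countable (\<rat> \<inter> {0..<real n})" for n
      using countable_rat by (rule countable_subset[rotated]) auto
    fix r
    note joint[of "m + r", measurable]
    show "Measurable.pred (lborel \<Otimes>\<^sub>M M) (\<lambda>x. 1 \<le> right_eval (fst x + (m + r)) (shift 0 (snd x)) - ?y (fst x) (snd x))"
      by measurable
  qed
  note ind = borel_measurable_indicator_section[where A=lborel and B=M]
  have prob_t: "(\<integral>\<^sup>+ \<omega>. indicator {t. P t \<omega>} t \<partial>M) = ennreal (prob {\<omega> \<in> space M. P t \<omega>})"
    if "{\<omega> \<in> space M. P t \<omega>} \<in> events" for P and t :: real
  proof -
    have "(\<integral>\<^sup>+ \<omega>. indicator {t. P t \<omega>} t \<partial>M) = (\<integral>\<^sup>+ \<omega>. indicator {\<omega> \<in> space M. P t \<omega>} \<omega> \<partial>M)"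
      by (intro nn_integral_cong) (auto simp: indicator_def)
    then show ?thesis using that by (simp add: emeasure_eq_measure)
  qed
  \<comment> \<open>By the Markov property at the fixed time t, being in the interval at t and
    escaping from there for good after a delay m are independent.\<close>
  have prob_GS: "q * prob {\<omega> \<in> space M. ?G t \<omega>} = prob {\<omega> \<in> space M. ?G t \<omega> \<and> ?S t \<omega>}" for t
  proof (cases "0 \<le> t")
    case True
    have Q: "Measurable.pred (\<Pi>\<^sub>M u\<in>{0..t}. borel) (\<lambda>f. f t \<in> {a..<a + 1})"
    proof -
      have [measurable]: "(\<lambda>f. f t) \<in> borel_measurable (\<Pi>\<^sub>M u\<in>{0..t}. borel)"
        using True by (intro measurable_component_singleton) auto
      show ?thesis by measurable
    qed
    have "prob {\<omega> \<in> space M. past t \<omega> t \<in> {a..<a + 1} \<and> stays_above_after m (shift t \<omega>)} =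
        prob {\<omega> \<in> space M. past t \<omega> t \<in> {a..<a + 1}} * q"
      unfolding q(2) by (rule prob_past_shift[OF True Q measurable_stays_above_after[OF m]])
    moreover have "{\<omega> \<in> space M. past t \<omega> t \<in> {a..<a + 1}} = {\<omega> \<in> space M. ?G t \<omega>}"
      using True by (auto simp: past_apply y)
    moreover have "{\<omega> \<in> space M. past t \<omega> t \<in> {a..<a + 1} \<and> stays_above_after m (shift t \<omega>)} =
        {\<omega> \<in> space M. ?G t \<omega> \<and> ?S t \<omega>}"
    proof (intro Collect_cong conj_cong refl)
      fix \<omega> assume w: "\<omega> \<in> space M"
      show "past t \<omega> t \<in> {a..<a + 1} \<longleftrightarrow> ?G t \<omega>" using True w by (simp add: past_apply y)
      show "stays_above_after m (shift t \<omega>) \<longleftrightarrow> ?S t \<omega>" by (rule S[OF True w, symmetric])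
    qed
    ultimately show ?thesis by simp
  qed simp
  have ev: "{\<omega> \<in> space M. P t \<omega>} \<in> events"
    if "Measurable.pred (lborel \<Otimes>\<^sub>M M) (\<lambda>x. P (fst x) (snd x))" for P :: "real \<Rightarrow> 'a \<Rightarrow> bool" and t
    using measurable_compose[OF measurable_Pair1'[of t lborel M] that] by (simp add: pred_def)
  have SG: "Measurable.pred (lborel \<Otimes>\<^sub>M M) (\<lambda>x. ?G (fst x) (snd x) \<and> ?S (fst x) (snd x))"
    using G SS by (rule pred_intros_logic)
  have swap: "(\<integral>\<^sup>+ \<omega>. (\<integral>\<^sup>+ t. indicator {t. P t \<omega>} t \<partial>lborel) \<partial>M) =
      (\<integral>\<^sup>+ t. ennreal (prob {\<omega> \<in> space M. P t \<omega>}) \<partial>lborel)"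
    "(\<lambda>t. ennreal (prob {\<omega> \<in> space M. P t \<omega>})) \<in> borel_measurable lborel"
    if P: "Measurable.pred (lborel \<Otimes>\<^sub>M M) (\<lambda>x. P (fst x) (snd x))" for P :: "real \<Rightarrow> 'a \<Rightarrow> bool"
    using L.Fubini'[OF ind[OF P]] borel_measurable_nn_integral[OF ind[OF P]]
    by (simp_all add: prob_t[OF ev[OF P]])
  have "ennreal q * (\<integral>\<^sup>+ \<omega>. (\<integral>\<^sup>+ t. indicator {t. ?G t \<omega>} t \<partial>lborel) \<partial>M) =
      (\<integral>\<^sup>+ t. ennreal q * ennreal (prob {\<omega> \<in> space M. ?G t \<omega>}) \<partial>lborel)"
    unfolding swap(1)[OF G] by (rule nn_integral_cmult[OF swap(2)[OF G], symmetric])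
  also have "\<dots> = (\<integral>\<^sup>+ t. ennreal (prob {\<omega> \<in> space M. ?G t \<omega> \<and> ?S t \<omega>}) \<partial>lborel)"
    using q(1) by (intro nn_integral_cong) (simp only: prob_GS ennreal_mult[symmetric] measure_nonneg less_imp_le)
  also have "\<dots> = (\<integral>\<^sup>+ \<omega>. (\<integral>\<^sup>+ t. indicator {t. ?G t \<omega> \<and> ?S t \<omega>} t \<partial>lborel) \<partial>M)"
    by (rule swap(1)[OF SG, symmetric])
  also have "\<dots> \<le> (\<integral>\<^sup>+ \<omega>. ennreal m \<partial>M)"
  proof (rule nn_integral_mono)
    fix \<omega> assume w: "\<omega> \<in> space M"
    let ?T = "{t. ?G t \<omega> \<and> ?S t \<omega>}"
    \<comment> \<open>Escape from t' puts the path at least 1 higher at all times from t' + m on,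
      hence outside the interval of length 1. So the times in \<open>?T\<close> spread over at most
      m.\<close>
    have le: "t \<le> t' + m" if "t \<in> ?T" "t' \<in> ?T" for t t'
    proof (rule ccontr)
      assume "\<not> t \<le> t' + m"
      then have "m \<le> t - t'" by simp
      have t: "0 \<le> t" "0 \<le> t'" "Y t \<omega> < a + 1" "a \<le> Y t' \<omega>" "stays_above_after m (shift t' \<omega>)"
        using that S[OF _ w] by (auto simp: y[OF _ w])
      then have "\<forall>u\<ge>m. 1 \<le> Y (t' + u) \<omega> - Y t' \<omega>"
        using stays_above_after_shift_iff[OF w _ m] by blast
      with \<open>m \<le> t - t'\<close> have "1 \<le> Y (t' + (t - t')) \<omega> - Y t' \<omega>" by blast
      then show False using t by simp
    qed
    show "(\<integral>\<^sup>+ t. indicator ?T t \<partial>lborel) \<le> ennreal m"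
    proof (cases "?T = {}")
      case False
      have bdd: "bdd_below ?T" by (intro bdd_belowI[of _ 0]) auto
      have "?T \<subseteq> {Inf ?T..Inf ?T + m}"
      proof
        fix t assume t: "t \<in> ?T"
        have "t - m \<le> Inf ?T" using False le[OF t] by (intro cInf_greatest) (auto simp: algebra_simps)
        then show "t \<in> {Inf ?T..Inf ?T + m}" using cInf_lower[OF t bdd] by simp
      qed
      then have "(\<integral>\<^sup>+ t. indicator ?T t \<partial>lborel) \<le> (\<integral>\<^sup>+ t. indicator {Inf ?T..Inf ?T + m} t \<partial>lborel)"
        by (intro nn_integral_mono) (auto simp: indicator_def)
      also have "\<dots> = ennreal m" using m by simp
      finally show ?thesis .
    qed simp
  qed
  also have "\<dots> = ennreal m" by (simp add: emeasure_space_1)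
  finally have "ennreal q * ?I \<le> ennreal m" .
  then have "ennreal (1 / q) * (ennreal q * ?I) \<le> ennreal (1 / q) * ennreal m"
    by (rule mult_left_mono) simp
  moreover have "ennreal (1 / q) * (ennreal q * ?I) = ?I"
    using q(1) by (simp add: mult.assoc[symmetric] ennreal_mult[symmetric])
  ultimately show ?thesis using q(1) m by (simp add: ennreal_mult[symmetric])
qed
text \<open>While the path is in [j, j+1[ the integrand is at most exp(-j), and the expected time
  there is bounded uniformly in j; the geometric series converges.\<close>

lemma exp_functional_finite:
  assumes drift: "drifts_to_infinity M Y"
  shows "AE \<omega> in M. exp_functional Y \<omega> < \<infinity>"
proof -
  obtain m :: real where m: "0 \<le> m" "0 < prob {\<omega> \<in> space M. stays_above_after m (shift 0 \<omega>)}"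
    using stays_above_after_pos[OF drift] .
  define q where "q = prob {\<omega> \<in> space M. stays_above_after m (shift 0 \<omega>)}"
  let ?y = "\<lambda>t \<omega>. right_eval t (shift 0 \<omega>)"
  let ?O = "\<lambda>j \<omega>. \<integral>\<^sup>+ t. indicator {t. 0 \<le> t \<and> ?y t \<omega> \<in> {real j..<real j + 1}} t \<partial>lborel"
  have my: "(\<lambda>x. ?y (fst x) (snd x)) \<in> borel_measurable (lborel \<Otimes>\<^sub>M M)"
    using measurable_joint[of 0] by (simp add: case_prod_beta)
  have mO: "?O j \<in> borel_measurable M" for j
  proof -
    have "Measurable.pred (lborel \<Otimes>\<^sub>M M) (\<lambda>x. 0 \<le> fst x \<and> ?y (fst x) (snd x) \<in> {real j..<real j + 1})"
      using my by measurable
    then have "(\<lambda>(t, \<omega>). indicator {t. 0 \<le> t \<and> ?y t \<omega> \<in> {real j..<real j + 1}} t :: ennreal)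
        \<in> borel_measurable (lborel \<Otimes>\<^sub>M M)"
      by (rule borel_measurable_indicator_section)
    from measurable_pair_swap[OF this] show ?thesis
      by (intro lborel.borel_measurable_nn_integral) simp
  qed
  have "(\<integral>\<^sup>+ \<omega>. (\<Sum>j. ennreal (exp (- real j)) * ?O j \<omega>) \<partial>M) =
      (\<Sum>j. ennreal (exp (- real j)) * (\<integral>\<^sup>+ \<omega>. ?O j \<omega> \<partial>M))"
    using mO by (simp add: nn_integral_suminf nn_integral_cmult)
  also have "\<dots> \<le> (\<Sum>j. ennreal (exp (- real j)) * ennreal (m / q))"
    using m by (intro suminf_le mult_left_mono occupation_time_le) (auto simp: q_def)
  also have "\<dots> = (\<Sum>j. ennreal (exp (- 1) ^ j * (m / q)))"
    by (simp add: ennreal_mult[symmetric] q_def m exp_of_nat_mult[symmetric])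
  also have "\<dots> < \<infinity>"
    using m by (subst suminf_ennreal2) (auto intro!: summable_mult2 summable_geometric simp: q_def)
  finally have "AE \<omega> in M. (\<Sum>j. ennreal (exp (- real j)) * ?O j \<omega>) \<noteq> \<infinity>"
    using mO by (intro nn_integral_noteq_infinite) auto
  then show ?thesis
    using drift[unfolded drifts_to_infinity_def] AE_space
  proof eventually_elim
    case (elim \<omega>)
    note w = elim(3)
    have "\<forall>\<^sub>F t in at_top. 0 \<le> Y t \<omega>" using elim(2) by (simp add: filterlim_at_top)
    then obtain T' where T': "\<And>t. T' \<le> t \<Longrightarrow> 0 \<le> Y t \<omega>" by (auto simp: eventually_at_top_linorder)
    \<comment> \<open>Negative values of the path are handled pathwise and not in expectation: they
      occur before T only, where a cadlag path is bounded.\<close>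
    define T where "T = max 0 T'"
    obtain b where b: "\<And>t. t \<in> {0..T} \<Longrightarrow> \<bar>Y t \<omega>\<bar> \<le> b" using cadlag_bounded[OF paths[OF w], where T = T] by blast
    have term_le: "f j \<le> (\<Sum>j. f j)" for f :: "nat \<Rightarrow> ennreal" and j
      using sum_le_suminf[of f "{j}"] by simp
    have "exp_functional Y \<omega> \<le> (\<integral>\<^sup>+ t. (\<Sum>j. ennreal (exp (- real j)) *
        indicator {t. 0 \<le> t \<and> ?y t \<omega> \<in> {real j..<real j + 1}} t) + ennreal (exp b) * indicator {0..T} t \<partial>lborel)"
      unfolding exp_functional_def
    proof (rule nn_integral_mono)
      fix t
      show "ennreal (exp (- Y t \<omega>)) * indicator {0..} t \<le> (\<Sum>j. ennreal (exp (- real j)) *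
        indicator {t. 0 \<le> t \<and> ?y t \<omega> \<in> {real j..<real j + 1}} t) + ennreal (exp b) * indicator {0..T} t" (is "_ \<le> (\<Sum>j. ?s j) + _")
      proof -
        consider "t < 0" | "t \<in> {0..T}" | "0 \<le> t" "0 \<le> Y t \<omega>"
          using T'[of t] unfolding T_def atLeastAtMost_iff by linarith
        then show ?thesis
        proof cases
          case 2
          then have "exp (- Y t \<omega>) \<le> exp b" using b[OF 2] by simp
          then show ?thesis using 2 by (intro add_increasing) (auto intro: ennreal_leI)
        next
          case 3
          define j where "j = nat \<lfloor>Y t \<omega>\<rfloor>"
          have j: "real j \<le> Y t \<omega>" "Y t \<omega> < real j + 1" using 3 by (auto simp: j_def)
          then have "ennreal (exp (- Y t \<omega>)) * indicator {0..} t \<le> ?s j"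
            using 3 w by (auto simp: right_eval_shift start intro!: ennreal_leI)
          also have "\<dots> \<le> (\<Sum>j. ?s j)" by (rule term_le)
          finally show ?thesis by (rule add_increasing2[rotated]) simp
        qed simp
      qed
    qed
    also have "\<dots> = (\<Sum>j. ennreal (exp (- real j)) * ?O j \<omega>) + ennreal (exp b) * emeasure lborel {0..T}"
    proof -
      have "shift 0 \<omega> \<in> space path_space" by (simp add: space_PiM shift_def)
      then have [measurable]: "(\<lambda>t. ?y t \<omega>) \<in> borel_measurable borel"
        using measurable_Pair_compose_split[OF measurable_right_eval measurable_ident measurable_const, of "shift 0 \<omega>"]
        by simp
      have [measurable]: "{t. 0 \<le> t \<and> ?y t \<omega> \<in> {real j..<real j + 1}} \<in> sets borel" for j
        by measurable
      show ?thesis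
        by (simp add: nn_integral_add nn_integral_suminf nn_integral_cmult)
    qed
    also have "\<dots> < \<infinity>"
      using elim(1) by (simp add: less_top[symmetric] ennreal_mult_eq_top_iff T_def)
    finally show ?case .
  qed
qed

lemma cdf_pos:
  assumes "AE \<omega> in M. exp_functional Y \<omega> < \<infinity>"
  obtains K where "0 < K" "0 < cdf K"
proof (rule ccontr)
  assume "\<not> thesis"
  then have zero: "prob {\<omega> \<in> space M. exp_functional Y \<omega> \<le> ennreal (real (Suc n))} = 0" for n
    using that[of "real (Suc n)"] measure_nonneg[of M] by (auto simp: cdf_exp_functional_def order.order_iff_strict)
  have "AE \<omega> in M. \<not> exp_functional Y \<omega> \<le> ennreal (real (Suc n))" for n
    by (subst AE_iff_measurable[of "{\<omega> \<in> space M. exp_functional Y \<omega> \<le> ennreal (real (Suc n))}"])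
      (use zero[of n] in \<open>auto simp: emeasure_eq_measure\<close>)
  then have "AE \<omega> in M. \<forall>n. \<not> exp_functional Y \<omega> \<le> ennreal (real (Suc n))"
    unfolding AE_all_countable by blast
  then have "AE \<omega> in M. False"
    using assms
  proof eventually_elim
    case (elim \<omega>)
    obtain n where "exp_functional Y \<omega> < of_nat n" using elim(2) ennreal_Ex_less_of_nat by (auto simp: top_unique)
    also have "of_nat n \<le> ennreal (real (Suc n))" by (simp add: ennreal_of_nat_eq_real_of_nat ennreal_leI)
    finally have "exp_functional Y \<omega> \<le> ennreal (real (Suc n))" by (rule less_imp_le)
    with elim(1) show False by blast
  qed
  then show False by simp
qed

end

section \<open>Lower bounds on the distribution function\<close>

text \<open>The coefficient of L^2 on the left is 1/(2 \<sigma>), and the strict gap to c absorbs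
  all lower-order terms.\<close>

lemma quadratic_eventually_le:
  fixes a B C c \<sigma> :: real
  assumes "0 < \<sigma>" "1 / (2 * \<sigma>) < c"
  shows "\<forall>\<^sub>F L in at_top. a * ((L + B) / \<sigma>) + \<sigma> / 2 * ((L + B) / \<sigma>)\<^sup>2 + C \<le> c * L\<^sup>2"
proof -
  have "((\<lambda>L. (a * ((L + B) / \<sigma>) + \<sigma> / 2 * ((L + B) / \<sigma>)\<^sup>2 + C) / L\<^sup>2) \<longlongrightarrow> \<sigma> * (inverse \<sigma>)\<^sup>2 / 2) at_top"
    using assms(1) by real_asymp
  moreover have "\<sigma> * (inverse \<sigma>)\<^sup>2 / 2 = 1 / (2 * \<sigma>)"
    using assms(1) by (simp add: power2_eq_square field_simps)
  ultimately have "\<forall>\<^sub>F L in at_top. (a * ((L + B) / \<sigma>) + \<sigma> / 2 * ((L + B) / \<sigma>)\<^sup>2 + C) / L\<^sup>2 < c"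
    using assms(2) by (intro order_tendstoD) auto
  then show ?thesis
    using eventually_gt_at_top[of 0]
    by eventually_elim (simp add: field_simps)
qed

context levy_process
begin

lemma cdf_nonneg: "0 \<le> cdf x"
  by (simp add: cdf_exp_functional_def)

text \<open>One use of \<open>cdf_step\<close> carries positivity from y to r y for a fixed r
  strictly between exp(-\<sigma>) and 1, and powers of r reach below any x > 0.\<close>

lemma cdf_pos_all:
  assumes jp: "0 < c\<^sub>0" "0 < l\<^sub>0" "\<forall>l\<in>{0<..l\<^sub>0}. c\<^sub>0 * l \<le> jump_prob \<sigma> \<eta> l"
    and \<sigma>: "0 < \<sigma>" and K: "0 < K" "0 < cdf K" and x: "0 < x"
  shows "0 < cdf x"
proof -
  obtain r where r: "exp (- \<sigma>) < r" "r < 1" using dense[of "exp (- \<sigma>)" 1] \<sigma> by auto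
  have r0: "0 < r" using r(1) exp_gt_zero[of "- \<sigma>"] by linarith
  have "0 < cdf (r ^ n * K)" for n
  proof (induction n)
    case (Suc n)
    let ?y = "r ^ n * K"
    \<comment> \<open>The second bound spends the gap between exp(-\<sigma>) y and r y on the
      integral up to time l.\<close>
    define l where "l = min l\<^sub>0 ((r - exp (- \<sigma>)) * ?y * exp (- \<eta>))"
    have y: "0 < ?y" using r0 K by simp
    then have l: "0 < l" "l \<le> l\<^sub>0" using jp(2) r(1) by (auto simp: l_def)
    have "l * exp \<eta> \<le> (r - exp (- \<sigma>)) * ?y * exp (- \<eta>) * exp \<eta>"
      unfolding l_def by (intro mult_right_mono) auto
    also have "\<dots> = (r - exp (- \<sigma>)) * ?y" by (simp add: exp_minus)
    finally have le: "l * exp \<eta> + exp (- \<sigma>) * ?y \<le> r ^ Suc n * K"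
      by (simp add: algebra_simps)
    have "0 < c\<^sub>0 * l * cdf ?y" using jp(1) l Suc by simp
    also have "\<dots> \<le> jump_prob \<sigma> \<eta> l * cdf ?y" using jp(3) l cdf_nonneg by (intro mult_right_mono) auto
    also have "\<dots> \<le> cdf (l * exp \<eta> + exp (- \<sigma>) * ?y)" using l y by (intro cdf_step) auto
    also have "\<dots> \<le> cdf (r ^ Suc n * K)" using le by (rule cdf_mono)
    finally show ?case .
  qed (use K in simp)
  moreover obtain n where "r ^ n < x / K" using real_arch_pow_inv[of "x / K" r] x K r by auto
  then have "r ^ n * K \<le> x" using K by (simp add: field_simps)
  then have "cdf (r ^ n * K) \<le> cdf x" by (rule cdf_mono)
  ultimately show ?thesis by (rule less_le_trans)
qed

text \<open>A step with target level \<open>r = exp (- \<sigma>')\<close> slightly above \<open>exp (- \<sigma>)\<close> can afford a time of order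
  \<open>y\<close>, so \<open>cdf (r * y) \<ge> \<kappa> * y * cdf y\<close>. Along \<open>y = r ^ n\<close> the exponents add up to
  \<open>\<sigma>' * n\<^sup>2 / 2\<close>, and \<open>n\<close> is about \<open>ln (1 / x) / \<sigma>'\<close>.\<close>

lemma cdf_lower_bound:
  assumes jp: "0 < c\<^sub>0" "0 < l\<^sub>0" "\<forall>l\<in>{0<..l\<^sub>0}. c\<^sub>0 * l \<le> jump_prob \<sigma> \<eta> l"
    and \<sigma>: "0 < \<sigma>" and K: "0 < K" "0 < cdf K" and c: "1 / (2 * \<sigma>) < c"
  shows "\<forall>\<^sub>F x in at_right 0. exp (- c * (ln x)\<^sup>2) \<le> cdf x"
proof -
  have c0: "0 < c" using c \<sigma> by (meson divide_pos_pos less_trans mult_pos_pos zero_less_numeral zero_less_one)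
  have "1 / (2 * c) < \<sigma>" using c c0 \<sigma> by (simp add: field_simps)
  \<comment> \<open>Being below \<sigma> leaves room for a positive time in each step; being above
    1/(2 c) keeps the resulting constant 1/(2 \<sigma>') below c.\<close>
  then obtain \<sigma>' where \<sigma>': "1 / (2 * c) < \<sigma>'" "\<sigma>' < \<sigma>" using dense by blast
  have \<sigma>'0: "0 < \<sigma>'" using \<sigma>'(1) c0 by (meson divide_pos_pos less_trans mult_pos_pos zero_less_numeral zero_less_one)
  have c': "1 / (2 * \<sigma>') < c" using \<sigma>'(1) c0 \<sigma>'0 by (simp add: field_simps)
  define r where "r = exp (- \<sigma>')"
  \<comment> \<open>With time d y the two terms of \<open>cdf_step\<close> add up to exactly r
    y.\<close>
  define d where "d = (r - exp (- \<sigma>)) * exp (- \<eta>)"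
  have d: "0 < d" using \<sigma>'(2) by (simp add: d_def r_def)
  have step: "c\<^sub>0 * d * y * cdf y \<le> cdf (r * y)" if y: "0 < y" "y \<le> l\<^sub>0 / d" for y
  proof -
    have l: "0 < d * y" "d * y \<le> l\<^sub>0" using y d by (simp_all add: field_simps)
    have "c\<^sub>0 * d * y * cdf y = c\<^sub>0 * (d * y) * cdf y" by simp
    also have "\<dots> \<le> jump_prob \<sigma> \<eta> (d * y) * cdf y" using jp(3) l cdf_nonneg by (intro mult_right_mono) auto
    also have "\<dots> \<le> cdf (d * y * exp \<eta> + exp (- \<sigma>) * y)" using l y by (intro cdf_step) auto
    also have "d * y * exp \<eta> + exp (- \<sigma>) * y = r * y" by (simp add: d_def exp_minus algebra_simps)
    finally show ?thesis .
  qed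
  define y\<^sub>1 where "y\<^sub>1 = l\<^sub>0 / d"
  \<comment> \<open>The absolute value gives both exp(-a) \<le>
    \<open>c\<^sub>0 * d * y\<^sub>1\<close> and a \<ge> 0; the latter makes the exponent increasing
    in n when n is replaced by its upper bound.\<close>
  define a where "a = \<bar>ln (c\<^sub>0 * d * y\<^sub>1)\<bar>"
  have y1: "0 < y\<^sub>1" using d jp(2) by (simp add: y\<^sub>1_def)
  have g: "0 < cdf y\<^sub>1" using jp \<sigma> K y1 by (rule cdf_pos_all)
  \<comment> \<open>From n to n+1 the term \<sigma>' n^2 / 2 grows by \<sigma>' n + \<sigma>' / 2.
    The step itself costs a + \<sigma>' n, so the half is given away.\<close>
  have iter: "cdf y\<^sub>1 * exp (- (a * real n + \<sigma>' / 2 * (real n)\<^sup>2)) \<le> cdf (r ^ n * y\<^sub>1)" for n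
  proof (induction n)
    case (Suc n)
    have rn: "r ^ n = exp (- \<sigma>' * real n)" by (simp add: r_def exp_of_nat_mult[symmetric] mult.commute)
    have "- a \<le> ln (c\<^sub>0 * d * y\<^sub>1)" by (simp add: a_def abs_if)
    then have "exp (- a) \<le> c\<^sub>0 * d * y\<^sub>1" using jp(1) d y1 by (subst (asm) ln_ge_iff) auto
    then have "exp (- a) * r ^ n \<le> c\<^sub>0 * d * y\<^sub>1 * r ^ n" by (intro mult_right_mono) (auto simp: r_def)
    moreover have "exp (- (a + \<sigma>' * real n + \<sigma>' / 2)) \<le> exp (- a) * r ^ n"
      using \<sigma>'0 by (simp add: rn exp_add[symmetric])
    ultimately have fac: "exp (- (a + \<sigma>' * real n + \<sigma>' / 2)) \<le> c\<^sub>0 * d * (r ^ n * y\<^sub>1)" by (simp add: mult_ac)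
    have "cdf y\<^sub>1 * exp (- (a * real (Suc n) + \<sigma>' / 2 * (real (Suc n))\<^sup>2)) =
        exp (- (a + \<sigma>' * real n + \<sigma>' / 2)) * (cdf y\<^sub>1 * exp (- (a * real n + \<sigma>' / 2 * (real n)\<^sup>2)))"
      by (simp add: exp_add[symmetric] mult.left_commute power2_eq_square algebra_simps add_divide_distrib)
    also have "\<dots> \<le> (c\<^sub>0 * d * (r ^ n * y\<^sub>1)) * cdf (r ^ n * y\<^sub>1)"
      using fac Suc cdf_nonneg by (intro mult_mono) (auto intro: order_trans[OF exp_ge_zero])
    also have "\<dots> \<le> cdf (r * (r ^ n * y\<^sub>1))"
    proof (rule step)
      have "r ^ n \<le> 1" using \<sigma>'0 by (intro power_le_one) (auto simp: r_def)
      then show "r ^ n * y\<^sub>1 \<le> l\<^sub>0 / d" unfolding y\<^sub>1_def[symmetric] using y1 by simp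
    qed (use y1 in \<open>simp add: r_def\<close>)
    finally show ?case by (simp add: mult.assoc)
  qed simp
  \<comment> \<open>The first summand corrects for the starting point \<open>y\<^sub>1\<close>, the
    second for rounding up the number of steps.\<close>
  define B where "B = \<bar>ln y\<^sub>1\<bar> + \<sigma>'"
  have "\<forall>\<^sub>F L in at_top. a * ((L + B) / \<sigma>') + \<sigma>' / 2 * ((L + B) / \<sigma>')\<^sup>2 + (- ln (cdf y\<^sub>1)) \<le> c * L\<^sup>2"
    using \<sigma>'0 c' by (rule quadratic_eventually_le)
  moreover have "filterlim (\<lambda>x::real. - ln x) at_top (at_right 0)" by real_asymp
  ultimately have "\<forall>\<^sub>F x in at_right 0. a * ((- ln x + B) / \<sigma>') + \<sigma>' / 2 * ((- ln x + B) / \<sigma>')\<^sup>2 + (- ln (cdf y\<^sub>1)) \<le> c * (- ln x)\<^sup>2"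
    by (rule eventually_compose_filterlim)
  moreover have "\<forall>\<^sub>F x in at_right (0::real). x < 1" "\<forall>\<^sub>F x in at_right (0::real). 0 < x"
    by real_asymp+
  ultimately show ?thesis
  proof eventually_elim
    case (elim x)
    define L where "L = - ln x"
    have L: "0 < L" using elim by (simp add: L_def)
    define n where "n = nat \<lceil>(L + \<bar>ln y\<^sub>1\<bar>) / \<sigma>'\<rceil>"
    have n: "(L + \<bar>ln y\<^sub>1\<bar>) / \<sigma>' \<le> real n" unfolding n_def by (rule real_nat_ceiling_ge)
    have "0 \<le> (L + \<bar>ln y\<^sub>1\<bar>) / \<sigma>'" using L \<sigma>'0 by simp
    then have "real n \<le> (L + \<bar>ln y\<^sub>1\<bar>) / \<sigma>' + 1" unfolding n_def by linarith
    also have "\<dots> = (L + B) / \<sigma>'" using \<sigma>'0 by (simp add: B_def field_simps)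
    finally have n': "real n \<le> (L + B) / \<sigma>'" .
    have "L + \<bar>ln y\<^sub>1\<bar> \<le> real n * \<sigma>'" using n \<sigma>'0 by (simp add: field_simps)
    then have "- (real n * \<sigma>') + ln y\<^sub>1 \<le> ln x" by (simp add: L_def)
    then have "exp (- (real n * \<sigma>') + ln y\<^sub>1) \<le> x" using elim by (simp add: ln_ge_iff)
    then have "r ^ n * y\<^sub>1 \<le> x"
      using y1 by (simp add: exp_diff exp_minus r_def exp_of_nat2_mult power_inverse divide_inverse mult.commute)
    then have "cdf (r ^ n * y\<^sub>1) \<le> cdf x" by (rule cdf_mono)
    moreover have "exp (- c * (ln x)\<^sup>2) \<le> cdf y\<^sub>1 * exp (- (a * real n + \<sigma>' / 2 * (real n)\<^sup>2))"
    proof -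
      have "a * real n + \<sigma>' / 2 * (real n)\<^sup>2 \<le> a * ((L + B) / \<sigma>') + \<sigma>' / 2 * ((L + B) / \<sigma>')\<^sup>2"
        using n' \<sigma>'0 by (intro add_mono mult_left_mono power_mono) (auto simp: a_def)
      then have "a * real n + \<sigma>' / 2 * (real n)\<^sup>2 + (- ln (cdf y\<^sub>1)) \<le> c * (ln x)\<^sup>2"
        using elim(1) by (simp add: L_def)
      then have "exp (- c * (ln x)\<^sup>2) \<le> exp (ln (cdf y\<^sub>1) + - (a * real n + \<sigma>' / 2 * (real n)\<^sup>2))"
        by simp
      then show ?thesis using g by (simp only: exp_add exp_ln)
    qed
    ultimately show ?case using iter[of n] by linarith
  qed
qed

end

section \<open>Support and tail of the Levy measure\<close>

text \<open>If no positive point were in the support, each would have a null neighbourhood; by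
  Lindelof countably many of these cover the positive half-line, which would then be null.\<close>

lemma sup_positive_jumps_pos:
  assumes "sets \<pi> = sets borel" "has_positive_jumps \<pi>"
  shows "0 < sup_positive_jumps \<pi>"
proof (rule ccontr)
  assume "\<not> 0 < sup_positive_jumps \<pi>"
  define \<mu> where "\<mu> = density \<pi> (indicator {0<..})"
  have sets: "sets \<mu> = sets borel" by (simp add: \<mu>_def assms(1))
  have \<mu>: "emeasure \<mu> U = emeasure \<pi> ({0<..} \<inter> U)" if "U \<in> sets borel" for U
    unfolding \<mu>_def using that assms(1)
    by (subst emeasure_density) (auto simp: nn_integral_indicator[symmetric] indicator_inter_arith mult.commute simp del: nn_integral_indicator
        intro!: nn_integral_cong)
  have "\<exists>U. open U \<and> x \<in> U \<and> emeasure \<mu> U = 0" if "0 < x" for x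
  proof -
    have "x \<notin> measure_support \<mu>"
    proof
      assume "x \<in> measure_support \<mu>"
      then have "ereal x \<le> sup_positive_jumps \<pi>"
        unfolding sup_positive_jumps_def \<mu>_def[symmetric] by (intro Sup_upper) auto
      then show False using that \<open>\<not> 0 < sup_positive_jumps \<pi>\<close>
        by (metis ereal_less(2) less_le_trans)
    qed
    then show ?thesis by (auto simp: measure_support_def)
  qed
  then obtain U where U: "\<And>x. 0 < x \<Longrightarrow> open (U x) \<and> x \<in> U x \<and> emeasure \<mu> (U x) = 0" by metis
  obtain F where F: "F \<subseteq> U ` {0<..}" "countable F" "\<Union>F = \<Union>(U ` {0<..})"
    using Lindelof[of "U ` {0<..}"] U by blast
  have "{0<..} \<subseteq> \<Union>F" using U unfolding F(3) by blast
  moreover have "\<Union>F \<in> null_sets \<mu>"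
  proof -
    have "A \<in> null_sets \<mu>" if "A \<in> F" for A
      using that F(1) U sets by (auto simp: null_sets_def)
    then have "(\<Union>A\<in>F. A) \<in> null_sets \<mu>" using F(2) by (intro null_sets_UN') auto
    then show ?thesis by simp
  qed
  moreover have "{0<..} \<in> sets \<mu>" using sets by simp
  ultimately have "emeasure \<mu> {0<..} = 0" by (metis null_setsD1 null_sets_subset)
  then show False using assms(2) \<mu>[of "{0<..}"] by (simp add: has_positive_jumps_def)
qed

lemma levy_tail_pos:
  assumes "sets \<pi> = sets borel" "0 \<le> s" "ereal s < sup_positive_jumps \<pi>"
  shows "0 < levy_tail \<pi> s"
proof -
  obtain x where x: "x \<in> measure_support (density \<pi> (indicator {0<..}))" "s < x"
    using assms(3) unfolding sup_positive_jumps_def less_Sup_iff by auto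
  then have "0 < emeasure (density \<pi> (indicator {0<..})) {s<..}"
    by (auto simp: measure_support_def)
  also have "\<dots> = (\<integral>\<^sup>+ y. indicator {0<..} y * indicator {s<..} y \<partial>\<pi>)"
    using assms(1) by (subst emeasure_density) auto
  also have "\<dots> \<le> (\<integral>\<^sup>+ y. indicator {s..} y \<partial>\<pi>)"
    by (intro nn_integral_mono) (auto simp: indicator_def)
  also have "\<dots> = levy_tail \<pi> s" using assms(1) by (simp add: levy_tail_def)
  finally show ?thesis .
qed

context levy_process
begin

lemma jump_prob_linear:
  assumes \<pi>: "is_levy_measure M Y \<pi>" and \<tau>: "0 < \<tau>" "3 * \<tau> < L" and pos: "0 < levy_tail \<pi> L"
  obtains c\<^sub>0 l\<^sub>0 where "0 < c\<^sub>0" "0 < l\<^sub>0"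
    "\<forall>l\<in>{0<..l\<^sub>0}. c\<^sub>0 * l \<le> jump_prob (L - 3 * \<tau>) (3 * \<tau>) l"
proof -
  obtain \<delta>\<^sub>0 where \<delta>\<^sub>0: "0 < \<delta>\<^sub>0" "\<forall>\<delta>\<in>{0<..\<delta>\<^sub>0}. \<forall>L>3 * \<tau>.
      ennreal \<delta> * levy_tail \<pi> L \<le> ennreal (8 * jump_prob (L - 3 * \<tau>) (3 * \<tau>) \<delta>)"
    using jump_prob_ge_levy_tail[OF \<pi> \<tau>(1)] .
  \<comment> \<open>The tail is an \<open>ennreal\<close> not yet known to be finite, so a positive
    real below it takes its place.\<close>
  obtain e where e: "0 < e" "ennreal e < levy_tail \<pi> L"
    using pos dense[of 0 "levy_tail \<pi> L"] by (metis ennreal_cases ennreal_less_zero_iff less_top_ennreal top.not_eq_extremum not_less_iff_gr_or_eq)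
  show ?thesis
  proof (rule that[of "e / 8" \<delta>\<^sub>0])
    show "\<forall>l\<in>{0<..\<delta>\<^sub>0}. e / 8 * l \<le> jump_prob (L - 3 * \<tau>) (3 * \<tau>) l"
    proof
      fix l assume "l \<in> {0<..\<delta>\<^sub>0}"
      then have l: "0 < l" "l \<le> \<delta>\<^sub>0" by auto
      have "ennreal (l * e) \<le> ennreal l * levy_tail \<pi> L"
        using e l by (simp add: ennreal_mult mult_left_mono less_imp_le)
      also have "\<dots> \<le> ennreal (8 * jump_prob (L - 3 * \<tau>) (3 * \<tau>) l)"
        using \<delta>\<^sub>0(2) l \<tau> by auto
      finally have "l * e \<le> 8 * jump_prob (L - 3 * \<tau>) (3 * \<tau>) l"
        by (subst (asm) ennreal_le_iff) (auto simp: jump_prob_def)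
      then show "e / 8 * l \<le> jump_prob (L - 3 * \<tau>) (3 * \<tau>) l" by (simp add: mult.commute)
    qed
  qed (use e \<delta>\<^sub>0 in auto)
qed

lemma jump_prob_linear_below_sup:
  assumes \<pi>: "is_levy_measure M Y \<pi>" and s: "0 < s" "ereal s < sup_positive_jumps \<pi>"
  obtains c\<^sub>0 l\<^sub>0 \<eta> where "0 < c\<^sub>0" "0 < l\<^sub>0"
    "\<forall>l\<in>{0<..l\<^sub>0}. c\<^sub>0 * l \<le> jump_prob s \<eta> l"
proof -
  obtain L where L: "ereal s < ereal L" "ereal L < sup_positive_jumps \<pi>"
    using ereal_dense2[OF s(2)] by auto
  \<comment> \<open>The loss 3 \<tau> in \<open>jump_prob_linear\<close> is made equal to the gap
    between s and L.\<close>
  define \<tau> where "\<tau> = (L - s) / 3"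
  have \<tau>: "0 < \<tau>" "3 * \<tau> < L" "L - 3 * \<tau> = s" using L s by (simp_all add: \<tau>_def field_simps)
  have "0 < levy_tail \<pi> L"
    using \<pi> L s by (intro levy_tail_pos) (auto simp: is_levy_measure_def)
  from jump_prob_linear[OF \<pi> \<tau>(1,2) this] show ?thesis using that unfolding \<tau>(3) by metis
qed

lemma cdf_ge_exp_square:
  assumes \<pi>: "is_levy_measure M Y \<pi>" and drift: "drifts_to_infinity M Y"
    and pos: "has_positive_jumps \<pi>" and c: "1 / (2 * sup_positive_jumps \<pi>) < ereal c"
  shows "\<forall>\<^sub>F x in at_right 0. exp (- c * (ln x)\<^sup>2) \<le> cdf x"
proof -
  have S: "0 < sup_positive_jumps \<pi>"
    using \<pi> pos by (intro sup_positive_jumps_pos) (auto simp: is_levy_measure_def)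
  \<comment> \<open>For a finite supremum, s is taken between 1/(2 c) and it. For an infinite one, s
    = 1/c gives 1/(2 s) = c/2.\<close>
  obtain s where s: "0 < s" "ereal s < sup_positive_jumps \<pi>" "1 / (2 * s) < c"
  proof (cases "sup_positive_jumps \<pi>")
    case (real S')
    then have S': "0 < S'" "1 / (2 * S') < c" using S c by (auto simp: one_ereal_def)
    then have c0: "0 < c" by (meson divide_pos_pos less_trans mult_pos_pos zero_less_numeral zero_less_one)
    then have "1 / (2 * c) < S'" using S' by (simp add: field_simps)
    then obtain s where s: "1 / (2 * c) < s" "s < S'" using dense by blast
    moreover have "0 < s" using s(1) c0 by (meson divide_pos_pos less_trans mult_pos_pos zero_less_numeral zero_less_one)
    moreover have "1 / (2 * s) < c" using s(1) c0 \<open>0 < s\<close> by (simp add: field_simps)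
    ultimately show ?thesis using that real by auto
  next
    case PInf
    then have c0: "0 < c" using c by (simp add: zero_ereal_def[symmetric])
    then show ?thesis using PInf by (intro that[of "1 / c"]) (auto simp: field_simps)
  qed (use S in auto)
  obtain c\<^sub>0 l\<^sub>0 \<eta> where jp: "0 < c\<^sub>0" "0 < l\<^sub>0" "\<forall>l\<in>{0<..l\<^sub>0}. c\<^sub>0 * l \<le> jump_prob s \<eta> l"
    using jump_prob_linear_below_sup[OF \<pi> s(1,2)] .
  obtain K where "0 < K" "0 < cdf K" using cdf_pos[OF exp_functional_finite[OF drift]] .
  then show ?thesis using jp s by (intro cdf_lower_bound[of c\<^sub>0 l\<^sub>0 s \<eta> K]) auto
qed

text \<open>A single step of the recursion, with a jump of size at least \<open>ln (1 / x)\<close>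
  within a time proportional to x, followed by a path whose functional is at most a fixed y.\<close>

lemma cdf_ge_levy_tail:
  assumes \<pi>: "is_levy_measure M Y \<pi>" and drift: "drifts_to_infinity M Y"
    and pos: "has_positive_jumps \<pi>"
  shows "\<exists>C>0. \<forall>\<^sub>F x in at_right 0. ennreal (C * x) * levy_tail \<pi> (ln (1 / x)) \<le> ennreal (cdf x)"
proof -
  have "0 < sup_positive_jumps \<pi>"
    using \<pi> pos by (intro sup_positive_jumps_pos) (auto simp: is_levy_measure_def)
  then obtain s where s: "ereal 0 < ereal s" "ereal s < sup_positive_jumps \<pi>"
    using ereal_dense2[of 0 "sup_positive_jumps \<pi>"] by (auto simp: zero_ereal_def)
  have s0: "0 < s" using s(1) by simp
  obtain c\<^sub>0 l\<^sub>0 \<eta> where jp: "0 < c\<^sub>0" "0 < l\<^sub>0" "\<forall>l\<in>{0<..l\<^sub>0}. c\<^sub>0 * l \<le> jump_prob s \<eta> l"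
    using jump_prob_linear_below_sup[OF \<pi> s0 s(2)] .
  obtain K where K: "0 < K" "0 < cdf K" using cdf_pos[OF exp_functional_finite[OF drift]] .
  \<comment> \<open>With time y x, floor -1 and end value at least \<open>ln (1 / x) - 1\<close>,
    both terms of \<open>cdf_step\<close> equal y x exp(1). The choice of y makes each of them
    x/2.\<close>
  define y :: real where "y = exp (- 1) / 2"
  have y: "0 < y" by (simp add: y_def)
  have cy: "0 < cdf y" using jp s0 K y by (rule cdf_pos_all)
  \<comment> \<open>The slack \<tau> = 1/3 turns the loss 3 \<tau> into 1 for all L at once.\<close>
  obtain \<delta>\<^sub>0 where \<delta>\<^sub>0: "0 < \<delta>\<^sub>0" "\<forall>\<delta>\<in>{0<..\<delta>\<^sub>0}. \<forall>L>3 * (1 / 3).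
      ennreal \<delta> * levy_tail \<pi> L \<le> ennreal (8 * jump_prob (L - 3 * (1 / 3)) (3 * (1 / 3)) \<delta>)"
    using jump_prob_ge_levy_tail[OF \<pi>, of "1 / 3"] by (simp del: mult_numeral_1_right) blast
  have "\<forall>\<^sub>F x in at_right 0. 0 < x \<and> y * x < \<delta>\<^sub>0 \<and> 1 < ln (1 / x)"
  proof (intro eventually_conj)
    have "((\<lambda>x. y * x) \<longlongrightarrow> y * 0) (at_right 0)" by (intro tendsto_intros)
    then show "\<forall>\<^sub>F x in at_right 0. y * x < \<delta>\<^sub>0" using \<delta>\<^sub>0(1) by (intro order_tendstoD(2)) auto
  qed real_asymp+
  then have "\<forall>\<^sub>F x in at_right 0. ennreal (y * cdf y / 8 * x) * levy_tail \<pi> (ln (1 / x)) \<le> ennreal (cdf x)"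
  proof eventually_elim
    case (elim x)
    let ?L = "ln (1 / x)" and ?s = "y * x"
    let ?q = "jump_prob (?L - 1) 1 ?s"
    have s: "0 < ?s" using elim y by simp
    have "?q * cdf y \<le> cdf (?s * exp 1 + exp (- (?L - 1)) * y)"
      using s y by (intro cdf_step) auto
    also have "?s * exp 1 + exp (- (?L - 1)) * y = x"
    proof -
      have "0 < x" using elim by simp
      then have "exp (- (?L - 1)) = x * exp 1" by (simp add: ln_div exp_add)
      then show ?thesis by (simp add: y_def exp_minus)
    qed
    finally have le: "?q * cdf y \<le> cdf x" .
    have "ennreal (y * cdf y / 8 * x) * levy_tail \<pi> ?L = ennreal (cdf y / 8) * (ennreal ?s * levy_tail \<pi> ?L)"
    proof -
      have "y * cdf y / 8 * x = cdf y / 8 * ?s" by simp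
      then have "ennreal (y * cdf y / 8 * x) = ennreal (cdf y / 8) * ennreal ?s"
        using ennreal_mult[of "cdf y / 8" ?s] cy s by (simp only: less_imp_le divide_nonneg_pos zero_less_numeral)
      then show ?thesis by (simp only: mult.assoc)
    qed
    also have "\<dots> \<le> ennreal (cdf y / 8) * ennreal (8 * ?q)"
      using elim s \<delta>\<^sub>0(2) by (intro mult_left_mono) auto
    also have "\<dots> = ennreal (?q * cdf y)"
      using cy by (subst ennreal_mult[symmetric]) (auto simp: jump_prob_def mult.commute)
    also have "\<dots> \<le> ennreal (cdf x)" using le by (rule ennreal_leI)
    finally show ?case .
  qed
  then show ?thesis using y cy by (intro exI[of _ "y * cdf y / 8"]) auto
qed

end

section \<open>The Poisson case\<close>

lemma (in levy_process) levy_process_scaled: "levy_process M (\<lambda>t \<omega>. \<alpha> * Y t \<omega>)"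
proof (unfold_locales, goal_cases)
  case (1 t)
  then show ?case using rv[of t] by simp
next
  case (2 \<omega>)
  then show ?case by (simp add: start)
next
  case (3 \<omega>)
  show ?case unfolding cadlag_def
  proof (intro conjI allI impI)
    fix t :: real assume "0 \<le> t"
    then show "((\<lambda>t. \<alpha> * Y t \<omega>) \<longlongrightarrow> \<alpha> * Y t \<omega>) (at_right t)"
      using cadlag_right_tendsto[OF paths[OF 3]] by (intro tendsto_intros)
  next
    fix t :: real assume "0 < t"
    then obtain l where "((\<lambda>t. Y t \<omega>) \<longlongrightarrow> l) (at_left t)" using paths[OF 3] unfolding cadlag_def by blast
    then have "((\<lambda>t. \<alpha> * Y t \<omega>) \<longlongrightarrow> \<alpha> * l) (at_left t)" by (intro tendsto_intros)
    then show "\<exists>l. ((\<lambda>t. \<alpha> * Y t \<omega>) \<longlongrightarrow> l) (at_left t)" ..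
  qed
next
  case (4 n t)
  have "indep_vars (\<lambda>_. borel) (\<lambda>i \<omega>. \<alpha> * (Y (t (Suc i)) \<omega> - Y (t i) \<omega>)) {..<n}"
    by (rule indep_vars_compose2[OF indep_increments[OF 4(1) 4(2)]]) simp
  then show ?case by (simp add: right_diff_distrib)
next
  case (5 s t)
  have m: "Y (s + t) \<in> borel_measurable M" "Y s \<in> borel_measurable M" "Y t \<in> borel_measurable M"
    using 5 by (auto intro: rv)
  have "distr M borel (\<lambda>\<omega>. \<alpha> * Y (s + t) \<omega> - \<alpha> * Y s \<omega>) =
      distr (distr M borel (\<lambda>\<omega>. Y (s + t) \<omega> - Y s \<omega>)) borel ((*) \<alpha>)"
    using m by (subst distr_distr) (auto simp: comp_def right_diff_distrib)
  also have "\<dots> = distr (distr M borel (Y t)) borel ((*) \<alpha>)"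
    using stationary_increments[OF 5] by simp
  also have "\<dots> = distr M borel (\<lambda>\<omega>. \<alpha> * Y t \<omega>)"
    using m by (subst distr_distr) (auto simp: comp_def)
  finally show ?case .
qed

text \<open>Summation by parts in inductive form: as partial sums are nonnegative, lowering the
  weight from \<open>a n\<close> to \<open>a (Suc n)\<close> on the earlier terms lowers the
  left-hand side.\<close>

lemma sum_mult_nonneg_of_partial_sums:
  fixes a d :: "nat \<Rightarrow> real"
  assumes "\<And>i. i \<le> n \<Longrightarrow> 0 \<le> a i" "\<And>i. i < n \<Longrightarrow> a (Suc i) \<le> a i"
    and "\<And>k. k \<le> Suc n \<Longrightarrow> 0 \<le> (\<Sum>i<k. d i)"
  shows "a n * (\<Sum>i<Suc n. d i) \<le> (\<Sum>i<Suc n. a i * d i)"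
  using assms
proof (induction n)
  case (Suc n)
  have "a (Suc n) * (\<Sum>i<Suc n. d i) \<le> a n * (\<Sum>i<Suc n. d i)"
    using Suc.prems(2)[of n] Suc.prems(3)[of "Suc n"] by (intro mult_right_mono) auto
  also have "\<dots> \<le> (\<Sum>i<Suc n. a i * d i)"
    using Suc.prems by (intro Suc.IH) auto
  finally show ?case
    unfolding sum.lessThan_Suc[of _ "Suc n"] by (simp only: distrib_left add_right_mono)
qed simp

section \<open>Moments, monotonicity and drift of the Poisson process\<close>

context poisson_process
begin

text \<open>The moment generating function of the Poisson law. Time 0 is treated apart because
  \<open>poisson_marginals\<close> speaks of positive times.\<close>

lemma nn_integral_poisson:
  assumes t: "0 \<le> t"
  shows "(\<integral>\<^sup>+ \<omega>. ennreal (exp (a * N t \<omega>)) \<partial>M) = ennreal (exp (p * t * (exp a - 1)))"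
proof (cases "t = 0")
  case True
  have "(\<integral>\<^sup>+ \<omega>. ennreal (exp (a * N t \<omega>)) \<partial>M) = (\<integral>\<^sup>+ \<omega>. 1 \<partial>M)"
    unfolding True by (intro nn_integral_cong) (simp add: start)
  then show ?thesis by (simp add: True emeasure_space_1)
next
  case False
  with t have t: "0 < t" by simp
  let ?r = "p * t"
  have r: "0 < ?r" using t intensity_pos by simp
  have "(\<lambda>k. (?r * exp a) ^ k /\<^sub>R fact k) sums exp (?r * exp a)" by (rule exp_converges)
  then have "(\<lambda>k. exp (- ?r) * ((?r * exp a) ^ k /\<^sub>R fact k)) sums (exp (- ?r) * exp (?r * exp a))"
    by (rule sums_mult)
  then have sums: "(\<lambda>k. pmf (poisson_pmf ?r) k * exp (a * real k)) sums exp (p * t * (exp a - 1))"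
    using r by (simp add: exp_add[symmetric] exp_of_nat2_mult power_mult_distrib divide_inverse algebra_simps)
  have "(\<integral>\<^sup>+ \<omega>. ennreal (exp (a * N t \<omega>)) \<partial>M) = (\<integral>\<^sup>+ x. ennreal (exp (a * x)) \<partial>distr M borel (N t))"
    using rv[of t] t by (subst nn_integral_distr) auto
  also have "\<dots> = (\<integral>\<^sup>+ k. ennreal (exp (a * real k)) \<partial>measure_pmf (poisson_pmf ?r))"
    unfolding poisson_marginals[OF t] by (subst nn_integral_distr) auto
  also have "\<dots> = (\<Sum>k. ennreal (pmf (poisson_pmf ?r) k * exp (a * real k)))"
    by (simp add: nn_integral_measure_pmf nn_integral_count_space_nat ennreal_mult)
  also have "\<dots> = ennreal (exp (p * t * (exp a - 1)))"
    using sums by (intro suminf_ennreal_eq) auto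
  finally show ?thesis .
qed

lemma AE_increment_nonneg:
  assumes "0 \<le> s" "s \<le> t"
  shows "AE \<omega> in M. N s \<omega> \<le> N t \<omega>"
proof (cases "s = t")
  case False
  with assms have t: "0 < t - s" by simp
  have m: "N s \<in> borel_measurable M" "N t \<in> borel_measurable M" using assms by (auto intro: rv)
  have "AE x in distr M borel (\<lambda>\<omega>. N (s + (t - s)) \<omega> - N s \<omega>). 0 \<le> x"
    using assms t unfolding stationary_increments[OF assms(1) less_imp_le[OF t]] poisson_marginals[OF t]
    by (subst AE_distr_iff) auto
  then show ?thesis
    using m by (subst (asm) AE_distr_iff) auto
qed simp

text \<open>Increments are almost surely nonnegative for countably many rational times at once, and
  right-continuity extends this to all later times.\<close>

lemma AE_mono_from:
  assumes t: "0 \<le> t"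
  shows "AE \<omega> in M. \<forall>u\<ge>t. N t \<omega> \<le> N u \<omega>"
proof -
  have "AE \<omega> in M. \<forall>q\<in>\<rat> \<inter> {t<..}. N t \<omega> \<le> N q \<omega>"
    using t countable_rat
    by (subst AE_ball_countable) (auto intro: AE_increment_nonneg countable_subset[of _ \<rat>])
  then show ?thesis
    using AE_space
  proof eventually_elim
    case (elim \<omega>)
    show ?case
    proof (intro allI impI, rule ccontr)
      fix u assume u: "t \<le> u" "\<not> N t \<omega> \<le> N u \<omega>"
      have "\<forall>\<^sub>F v in at_right u. N v \<omega> < N t \<omega>"
        using u t by (intro order_tendstoD(2)[OF right_tendsto[OF elim(2)]]) auto
      then obtain b where b: "u < b" "\<And>v. u < v \<Longrightarrow> v < b \<Longrightarrow> N v \<omega> < N t \<omega>"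
        by (auto simp: eventually_at_right_field)
      obtain q where "q \<in> \<rat>" "u < q" "q < b" using Rats_dense_in_real[OF b(1)] by auto
      then show False using elim(1) b(2)[of q] u(1) by force
    qed
  qed
qed

lemma AE_mono_upto:
  assumes t: "0 \<le> t"
  shows "AE \<omega> in M. \<forall>u\<in>{0..<t}. N u \<omega> \<le> N t \<omega>"
proof -
  have "AE \<omega> in M. \<forall>q\<in>\<rat> \<inter> {0..<t}. N q \<omega> \<le> N t \<omega>"
    using countable_rat
    by (subst AE_ball_countable) (auto intro: AE_increment_nonneg countable_subset[of _ \<rat>])
  then show ?thesis
    using AE_space
  proof eventually_elim
    case (elim \<omega>)
    have "stays_in {..N t \<omega>} t (\<lambda>u. N u \<omega>)" using elim(1) by (simp add: stays_in_def)
    then show ?case using stays_in_iff[OF right_tendsto[OF elim(2)], of "{..N t \<omega>}" t] by simp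
  qed
qed

text \<open>Markov's inequality for exp(-N) shows that the probability of staying at or below k at
  time n decays exponentially in n. So the path is unbounded along integers, and monotonicity turns
  this into divergence.\<close>

lemma drifts: "drifts_to_infinity M N"
proof -
  have "AE \<omega> in M. \<exists>n::nat. real k < N (real n) \<omega>" for k :: nat
  proof -
    let ?A = "\<lambda>n::nat. {\<omega> \<in> space M. N (real n) \<omega> \<le> real k}"
    have [measurable]: "?A n \<in> events" for n
      using rv[of "real n"] by measurable
    have le: "prob (\<Inter>n. ?A n) \<le> exp (real k) * exp (p * real n * (exp (- 1) - 1))" for n
    proof -
      have "emeasure M (\<Inter>n. ?A n) \<le> (\<integral>\<^sup>+ \<omega>. indicator (?A n) \<omega> \<partial>M)"
        by (subst nn_integral_indicator) (auto intro!: emeasure_mono)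
      also have "\<dots> \<le> (\<integral>\<^sup>+ \<omega>. ennreal (exp (real k)) * ennreal (exp (- 1 * N (real n) \<omega>)) \<partial>M)"
        by (intro nn_integral_mono) (auto simp: indicator_def ennreal_mult[symmetric] exp_add[symmetric])
      also have "\<dots> = ennreal (exp (real k)) * ennreal (exp (p * real n * (exp (- 1) - 1)))"
        using rv[of "real n"] by (subst nn_integral_cmult) (auto simp: nn_integral_poisson[of "real n" "- 1", simplified])
      finally show ?thesis
        by (simp add: emeasure_eq_measure ennreal_mult[symmetric])
    qed
    define c where "c = p * (1 - exp (- 1))"
    have "0 < c" using intensity_pos by (simp add: c_def)
    then have "(\<lambda>n. exp (real k) * exp (- c * real n)) \<longlonglongrightarrow> 0" by real_asymp
    moreover have "- c * real n = p * real n * (exp (- 1) - 1)" for n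
      by (simp add: c_def algebra_simps)
    ultimately have "(\<lambda>n. exp (real k) * exp (p * real n * (exp (- 1) - 1))) \<longlonglongrightarrow> 0" by (simp only:)
    then have "prob (\<Inter>n. ?A n) \<le> 0"
      by (rule LIMSEQ_le_const) (use le in blast)
    then have "prob (\<Inter>n. ?A n) = 0" by (simp add: measure_le_0_iff)
    moreover have "{\<omega> \<in> space M. \<not> (\<exists>n::nat. real k < N (real n) \<omega>)} = (\<Inter>n. ?A n)"
      by (auto simp: not_less)
    ultimately show ?thesis
      by (subst AE_iff_measurable[of "\<Inter>n. ?A n"]) (auto simp: emeasure_eq_measure)
  qed
  then have "AE \<omega> in M. \<forall>k::nat. \<exists>n::nat. real k < N (real n) \<omega>"
    unfolding AE_all_countable by blast
  moreover have "AE \<omega> in M. \<forall>n::nat. \<forall>u\<ge>real n. N (real n) \<omega> \<le> N u \<omega>"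
    unfolding AE_all_countable using AE_mono_from by simp
  ultimately show ?thesis
    unfolding drifts_to_infinity_def
  proof eventually_elim
    case (elim \<omega>)
    show ?case
      unfolding filterlim_at_top
    proof
      fix Z :: real
      obtain k :: nat where "Z \<le> real k" using real_arch_simple by blast
      moreover obtain n :: nat where "real k < N (real n) \<omega>" using elim(1) by blast
      ultimately have "Z \<le> N u \<omega>" if "real n \<le> u" for u
        using elim(2) that by (meson le_less_trans less_imp_le order_trans)
      then show "\<forall>\<^sub>F t in at_top. Z \<le> N t \<omega>" by (auto simp: eventually_at_top_linorder)
    qed
  qed
qed

text \<open>Here the Poisson law replaces the Levy measure, which is not part of the data in (3): at
  least one jump occurs with probability 1 - exp(-u), and exp(-u) \<le> 1/(1+u) \<le> 1 - u/2 for 0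
  \<le> u \<le> 1. Monotone paths allow the floor 0.\<close>

lemma jump_prob_scaled:
  assumes \<alpha>: "0 < \<alpha>" and l: "0 < l" "l \<le> 1 / p"
  shows "p / 2 * l \<le> levy_process.jump_prob M (\<lambda>t \<omega>. \<alpha> * N t \<omega>) \<alpha> 0 l"
proof -
  interpret S: levy_process M "\<lambda>t \<omega>. \<alpha> * N t \<omega>" by (rule levy_process_scaled)
  let ?u = "p * l"
  have u: "0 < ?u" "?u \<le> 1" using l intensity_pos by (auto simp: field_simps)
  have "exp (- ?u) \<le> 1 / (1 + ?u)"
    using exp_ge_add_one_self[of ?u] u by (simp add: exp_minus field_simps)
  also have "\<dots> \<le> 1 - ?u / 2"
  proof -
    have "?u * ?u \<le> ?u * 1" using u by (intro mult_left_mono) auto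
    then have "1 \<le> (1 - ?u / 2) * (1 + ?u)" by (simp add: algebra_simps)
    then show ?thesis using u by (subst pos_divide_le_eq) auto
  qed
  finally have "p / 2 * l \<le> 1 - exp (- ?u)" by simp
  also have "\<dots> = 1 - pmf (poisson_pmf ?u) 0" using u by simp
  also have "\<dots> = measure (measure_pmf (poisson_pmf ?u)) {k. 1 \<le> real k}"
  proof -
    have "{k. 1 \<le> real k} = UNIV - {0}" by auto
    then show ?thesis
      using measure_pmf.prob_compl[of "{0}" "poisson_pmf ?u"] by (simp add: measure_pmf_single)
  qed
  also have "\<dots> = measure (distr M borel (N l)) {1..}"
    unfolding poisson_marginals[OF l(1)] by (subst measure_distr) (auto simp: vimage_def)
  also have "\<dots> = prob {\<omega> \<in> space M. 1 \<le> N l \<omega>}"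
    using rv[of l] l by (subst measure_distr) (auto simp: vimage_def Int_def conj_commute)
  also have "\<dots> \<le> S.jump_prob \<alpha> 0 l"
    unfolding S.jump_prob_def
  proof (rule finite_measure_mono_AE)
    show "AE \<omega> in M. \<omega> \<in> {\<omega> \<in> space M. 1 \<le> N l \<omega>} \<longrightarrow>
        \<omega> \<in> {\<omega> \<in> space M. \<alpha> \<le> \<alpha> * N l \<omega> \<and> (\<forall>u\<in>{0..<l}. - 0 \<le> \<alpha> * N u \<omega>)}"
      using AE_mono_from[OF order_refl] AE_space
    proof eventually_elim
      case (elim \<omega>)
      then show ?case using \<alpha> by (auto simp: start)
    qed
    show "{\<omega> \<in> space M. \<alpha> \<le> \<alpha> * N l \<omega> \<and> (\<forall>u\<in>{0..<l}. - 0 \<le> \<alpha> * N u \<omega>)} \<in> events"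
      using l by (intro S.sets_jump_prob) auto
  qed
  finally show ?thesis .
qed

text \<open>On the event \<open>I \<le> x\<close> the process has made at least \<open>j\<close> jumps by time \<open>x * exp (\<alpha> * j)\<close>.
  Exponential weights \<open>ln (1 / t j)\<close> on the increments then give the product bound.\<close>

lemma cdf_scaled_le:
  assumes \<alpha>: "0 < \<alpha>" and x: "0 < x" and n: "x * exp (\<alpha> * real n) \<le> 1"
  shows "cdf_exp_functional M (\<lambda>t \<omega>. \<alpha> * N t \<omega>) x \<le> (\<Prod>i<n. exp p * (x * exp (\<alpha> * real (Suc i))))"
proof (cases n)
  case 0
  then show ?thesis by (simp add: cdf_exp_functional_def)
next
  case (Suc n')
  interpret S: levy_process M "\<lambda>t \<omega>. \<alpha> * N t \<omega>" by (rule levy_process_scaled)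
  \<comment> \<open>Index 0 is set to time 0, so that the increments add up to the value of the
    process.\<close>
  define t where "t j = (if j = 0 then 0 else x * exp (\<alpha> * real j))" for j
  have t0: "0 \<le> t j" for j using x by (simp add: t_def)
  have "t i \<le> t (Suc i)" for i using x \<alpha> by (auto simp: t_def)
  then have mono: "mono t" by (intro incseq_SucI)
  have tpos: "0 < t (Suc i)" for i using x by (simp add: t_def)
  have tle: "t (Suc i) \<le> 1" if "i < n" for i
  proof -
    have "x * exp (\<alpha> * real (Suc i)) \<le> x * exp (\<alpha> * real n)"
      using that \<alpha> x by (intro mult_left_mono) auto
    then show ?thesis using n by (simp add: t_def)
  qed
  \<comment> \<open>The weight balances the two effects of an exponential moment: exp(a i) t(i+1) =
    1 keeps the moment generating function below exp(p), while exp(-a i) = t(i+1) is the gain. The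
    hypothesis on n makes the weights nonnegative.\<close>
  define a where "a i = ln (1 / t (Suc i))" for i
  have a0: "0 \<le> a i" if "i < n" for i using tle[OF that] tpos[of i] by (simp add: a_def ln_ge_zero)
  have ea: "exp (a i) = 1 / t (Suc i)" for i using tpos[of i] by (simp add: a_def)
  have adec: "a (Suc i) \<le> a i" for i
    unfolding a_def using tpos monoD[OF mono, of "Suc i" "Suc (Suc i)"]
    by (intro ln_mono) (auto intro: divide_left_mono simp: tpos)
  define D where "D i \<omega> = N (t (Suc i)) \<omega> - N (t i) \<omega>" for i \<omega>
  have mD: "D i \<in> borel_measurable M" for i
    unfolding D_def[abs_def] using t0 by (intro borel_measurable_diff rv)
  have indep: "indep_vars (\<lambda>_. borel) (\<lambda>i \<omega>. ennreal (exp (a i * (D i \<omega> - 1)))) {..<n}"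
    unfolding D_def using indep_increments[OF t0 mono]
    by (rule indep_vars_compose2) measurable
  let ?A = "{\<omega> \<in> space M. exp_functional (\<lambda>t \<omega>. \<alpha> * N t \<omega>) \<omega> \<le> ennreal x}"
  have "AE \<omega> in M. \<forall>j. \<forall>u\<in>{0..<t j}. N u \<omega> \<le> N (t j) \<omega>"
    unfolding AE_all_countable using AE_mono_upto[OF t0] by blast
  \<comment> \<open>A Chernoff bound with one weight per increment: on the event, all partial sums
    of D i - 1 are nonnegative, and so is their sum with decreasing weights.\<close>
  then have dom: "AE \<omega> in M. indicator ?A \<omega> \<le> (\<Prod>i<n. ennreal (exp (a i * (D i \<omega> - 1))))"
    using AE_space
  proof eventually_elim
    case (elim \<omega>)
    show ?case
    proof (cases "\<omega> \<in> ?A")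
      case True
      \<comment> \<open>Before time t j the process is at most its value there, so the functional is
        at least t j exp(-\<alpha> N(t j)). Comparing with x leaves exp(\<alpha> j) \<le>
        exp(\<alpha> N(t j)).\<close>
      have count: "real j \<le> N (t j) \<omega>" if j: "0 < j" for j
      proof -
        have "ennreal (t j * exp (- (\<alpha> * N (t j) \<omega>))) = (\<integral>\<^sup>+ u. ennreal (exp (- (\<alpha> * N (t j) \<omega>))) * indicator {0..<t j} u \<partial>lborel)"
          using t0[of j] by (subst nn_integral_cmult_indicator) (auto simp: ennreal_mult[symmetric] mult.commute)
        also have "\<dots> \<le> exp_functional (\<lambda>t \<omega>. \<alpha> * N t \<omega>) \<omega>"
          unfolding exp_functional_def using elim(1) \<alpha>
          by (intro nn_integral_mono) (auto simp: indicator_def intro!: ennreal_leI)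
        also have "\<dots> \<le> ennreal x" using True by simp
        finally have "t j * exp (- (\<alpha> * N (t j) \<omega>)) \<le> x" using x by (simp add: ennreal_le_iff)
        then have "exp (\<alpha> * real j) \<le> exp (\<alpha> * N (t j) \<omega>)"
          using x j by (simp add: t_def exp_minus field_simps)
        then show ?thesis using \<alpha> by simp
      qed
      have sums: "0 \<le> (\<Sum>i<k. D i \<omega> - 1)" for k
      proof -
        have "(\<Sum>i<k. D i \<omega>) = N (t k) \<omega> - N (t 0) \<omega>"
          unfolding D_def by (rule sum_lessThan_telescope)
        then show ?thesis
          using count[of k] elim(2) by (cases "k = 0") (auto simp: sum_subtractf t_def start)
      qed
      have "0 \<le> a n' * (\<Sum>i<Suc n'. D i \<omega> - 1)"
        using a0[of n'] Suc sums[of "Suc n'"] by (intro mult_nonneg_nonneg) auto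
      also have "\<dots> \<le> (\<Sum>i<Suc n'. a i * (D i \<omega> - 1))"
        using a0 adec sums Suc by (intro sum_mult_nonneg_of_partial_sums) auto
      finally have "1 \<le> exp (\<Sum>i<n. a i * (D i \<omega> - 1))" by (simp add: Suc)
      then have "ennreal 1 \<le> ennreal (\<Prod>i<n. exp (a i * (D i \<omega> - 1)))"
        by (intro ennreal_leI) (simp add: exp_sum)
      then show ?thesis by (simp add: prod_ennreal indicator_def)
    qed simp
  qed
  have "ennreal (cdf_exp_functional M (\<lambda>t \<omega>. \<alpha> * N t \<omega>) x) = (\<integral>\<^sup>+ \<omega>. indicator ?A \<omega> \<partial>M)"
    by (simp add: cdf_exp_functional_def emeasure_eq_measure)
  also have "\<dots> \<le> (\<integral>\<^sup>+ \<omega>. (\<Prod>i<n. ennreal (exp (a i * (D i \<omega> - 1)))) \<partial>M)"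
    using dom by (rule nn_integral_mono_AE)
  also have "\<dots> = (\<Prod>i<n. \<integral>\<^sup>+ \<omega>. ennreal (exp (a i * (D i \<omega> - 1))) \<partial>M)"
    by (intro indep_vars_nn_integral indep) auto
  also have "\<dots> \<le> (\<Prod>i<n. ennreal (exp p * (x * exp (\<alpha> * real (Suc i)))))"
  proof (intro prod_mono_ennreal)
    fix i assume i: "i \<in> {..<n}"
    let ?s = "t (Suc i) - t i"
    have s: "0 \<le> ?s" using monoD[OF mono, of i "Suc i"] by simp
    have "(\<integral>\<^sup>+ \<omega>. ennreal (exp (a i * (D i \<omega> - 1))) \<partial>M) =
        (\<integral>\<^sup>+ y. ennreal (exp (- a i)) * ennreal (exp (a i * y)) \<partial>distr M borel (D i))"
      using mD[of i] by (subst nn_integral_distr)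
        (auto simp: ennreal_mult[symmetric] exp_add[symmetric] algebra_simps)
    also have "distr M borel (D i) = distr M borel (N ?s)"
      unfolding D_def[abs_def] using stationary_increments[OF t0[of i] s] by simp
    also have "(\<integral>\<^sup>+ y. ennreal (exp (- a i)) * ennreal (exp (a i * y)) \<partial>distr M borel (N ?s)) =
        ennreal (exp (- a i)) * (\<integral>\<^sup>+ \<omega>. ennreal (exp (a i * N ?s \<omega>)) \<partial>M)"
      using rv[OF s] by (subst nn_integral_distr) (auto simp: nn_integral_cmult)
    also have "\<dots> = ennreal (exp (- a i) * exp (p * ?s * (exp (a i) - 1)))"
      by (simp add: nn_integral_poisson[OF s] ennreal_mult)
    also have "\<dots> \<le> ennreal (exp p * (x * exp (\<alpha> * real (Suc i))))"
    proof (rule ennreal_leI)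
      have "?s * (exp (a i) - 1) \<le> t (Suc i) * (exp (a i) - 1)"
        using a0[of i] i t0[of i] by (intro mult_right_mono) auto
      also have "\<dots> = 1 - t (Suc i)" using tpos[of i] by (simp add: ea field_simps)
      also have "\<dots> \<le> 1" using tpos[of i] by simp
      finally have "p * ?s * (exp (a i) - 1) \<le> p * 1"
        unfolding mult.assoc using intensity_pos by (intro mult_left_mono) auto
      then have le: "exp (- a i) * exp (p * ?s * (exp (a i) - 1)) \<le> exp (- a i) * exp p" by simp
      have eq: "exp (- a i) = x * exp (\<alpha> * real (Suc i))" by (simp add: exp_minus ea t_def)
      show "exp (- a i) * exp (p * ?s * (exp (a i) - 1)) \<le> exp p * (x * exp (\<alpha> * real (Suc i)))"
        using le unfolding eq by (simp only: mult.commute[of "exp p"])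
    qed
    finally show "(\<integral>\<^sup>+ \<omega>. ennreal (exp (a i * (D i \<omega> - 1))) \<partial>M) \<le> ennreal (exp p * (x * exp (\<alpha> * real (Suc i))))" .
  qed
  also have "\<dots> = ennreal (\<Prod>i<n. exp p * (x * exp (\<alpha> * real (Suc i))))"
    using x by (intro prod_ennreal) auto
  finally show ?thesis
    using x by (subst (asm) ennreal_le_iff) (auto intro!: prod_nonneg)
qed

end

section \<open>The logarithmic equivalent in the Poisson case\<close>

context poisson_process
begin

lemma drifts_scaled:
  assumes "0 < \<alpha>"
  shows "drifts_to_infinity M (\<lambda>t \<omega>. \<alpha> * N t \<omega>)"
  using drifts unfolding drifts_to_infinity_def
  by eventually_elim (use assms in \<open>intro filterlim_tendsto_pos_mult_at_top[OF tendsto_const]\<close>)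

lemma neg_ln_cdf_scaled_ge:
  assumes \<alpha>: "0 < \<alpha>" and x: "0 < x" "x < 1"
    and pos: "0 < cdf_exp_functional M (\<lambda>t \<omega>. \<alpha> * N t \<omega>) x"
  shows "1 / (2 * \<alpha>) * (ln x)\<^sup>2 - (1 + p / \<alpha>) * (- ln x) \<le>
    - ln (cdf_exp_functional M (\<lambda>t \<omega>. \<alpha> * N t \<omega>) x)" (is "_ \<le> - ln ?F")
proof -
  define L where "L = - ln x"
  define n where "n = nat \<lfloor>L / \<alpha>\<rfloor>"
  have L: "0 < L" using x by (simp add: L_def)
  have "0 \<le> L / \<alpha>" using L \<alpha> by simp
  then have "real n \<le> L / \<alpha>" "L / \<alpha> - 1 \<le> real n" unfolding n_def by linarith+
  then have n: "\<alpha> * real n \<le> L" "L \<le> \<alpha> * real n + \<alpha>" using \<alpha> by (simp_all add: field_simps)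
  have ex: "x = exp (- L)" using x by (simp add: L_def)
  have "x * exp (\<alpha> * real n) \<le> 1" unfolding ex using n by (simp add: exp_add[symmetric])
  then have "cdf_exp_functional M (\<lambda>t \<omega>. \<alpha> * N t \<omega>) x \<le> (\<Prod>i<n. exp p * (x * exp (\<alpha> * real (Suc i))))"
    using \<alpha> x by (intro cdf_scaled_le)
  also have "\<dots> = exp (\<Sum>i<n. p - L + \<alpha> * real (Suc i))"
    by (simp add: exp_sum ex exp_add[symmetric] algebra_simps)
  also have "(\<Sum>i<n. p - L + \<alpha> * real (Suc i)) = real n * (p - L) + \<alpha> * (real n * (real n + 1) / 2)"
    by (induction n) (auto simp: field_simps)
  finally have "ln ?F \<le> ln (exp (real n * (p - L) + \<alpha> * (real n * (real n + 1) / 2)))"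
    using pos by (subst ln_le_cancel_iff) auto
  then have "ln ?F \<le> real n * (p - L) + \<alpha> * (real n * (real n + 1) / 2)" by simp
  then have 1: "ln ?F \<le> real n * p - real n * L + \<alpha> * real n * (real n + 1) / 2"
    by (simp add: right_diff_distrib)
  have "\<alpha> * real n * (real n + 1) \<le> L * (real n + 1)" using n by (intro mult_right_mono) auto
  then have 2: "\<alpha> * real n * (real n + 1) \<le> real n * L + L" by (simp add: algebra_simps)
  \<comment> \<open>Naming the two nonlinear terms Z and W, besides the products with n, makes the
    final comparison linear.\<close>
  define Z where "Z = L / \<alpha> * L"
  have "(L / \<alpha> - 1) * L \<le> real n * L" using \<open>L / \<alpha> - 1 \<le> real n\<close> L by (intro mult_right_mono) auto
  then have 3: "Z - L \<le> real n * L" by (simp add: Z_def left_diff_distrib)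
  define W where "W = p / \<alpha> * L"
  have "real n * p \<le> L / \<alpha> * p" using \<open>real n \<le> L / \<alpha>\<close> intensity_pos by (intro mult_right_mono) auto
  then have 4: "real n * p \<le> W" by (simp add: W_def mult.commute)
  from 1 2 3 4 have "Z / 2 - (L + W) \<le> - ln ?F" by argo
  moreover have "1 / (2 * \<alpha>) * (ln x)\<^sup>2 - (1 + p / \<alpha>) * (- ln x) = Z / 2 - (L + W)"
    by (simp add: Z_def W_def L_def power2_eq_square algebra_simps)
  ultimately show ?thesis by simp
qed

lemma neg_ln_cdf_scaled_asymp:
  assumes \<alpha>: "0 < \<alpha>"
  shows "(\<lambda>x. - ln (cdf_exp_functional M (\<lambda>t \<omega>. \<alpha> * N t \<omega>) x))
    \<sim>[at_right 0] (\<lambda>x. 1 / (2 * \<alpha>) * (ln x)\<^sup>2)"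
proof -
  interpret S: levy_process M "\<lambda>t \<omega>. \<alpha> * N t \<omega>" by (rule levy_process_scaled)
  have jp: "0 < p / 2" "0 < 1 / p" "\<forall>l\<in>{0<..1 / p}. p / 2 * l \<le> S.jump_prob \<alpha> 0 l"
    using intensity_pos jump_prob_scaled[OF \<alpha>] by auto
  obtain K where K: "0 < K" "0 < S.cdf K"
    using S.cdf_pos[OF S.exp_functional_finite[OF drifts_scaled[OF \<alpha>]]] .
  have pos: "0 < S.cdf x" if "0 < x" for x
    using jp \<alpha> K that by (rule S.cdf_pos_all)
  let ?f = "\<lambda>x. - ln (S.cdf x)" and ?g = "\<lambda>x. 1 / (2 * \<alpha>) * (ln x)\<^sup>2"
  have range: "\<forall>\<^sub>F x in at_right (0::real). 0 < x \<and> x < 1"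
    by (intro eventually_conj) real_asymp+
  have "((\<lambda>x. ?f x / ?g x) \<longlongrightarrow> 1) (at_right 0)"
  proof (rule order_tendstoI)
    fix a :: real assume a: "a < 1"
    \<comment> \<open>The linear error (1 + p/\<alpha>) L relative to L^2/(2 \<alpha>), with L = -ln
      x.\<close>
    have "((\<lambda>x. 1 - 2 * (\<alpha> + p) / (- ln x)) \<longlongrightarrow> 1) (at_right 0)" by real_asymp
    then have "\<forall>\<^sub>F x in at_right 0. a < 1 - 2 * (\<alpha> + p) / (- ln x)" using a by (rule order_tendstoD)
    then show "\<forall>\<^sub>F x in at_right 0. a < ?f x / ?g x"
      using range
    proof eventually_elim
      case (elim x)
      then have L: "0 < - ln x" by simp
      have "1 - 2 * (\<alpha> + p) / (- ln x) = (?g x - (1 + p / \<alpha>) * (- ln x)) / ?g x"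
        using L \<alpha> by (simp add: field_simps power2_eq_square)
      also have "\<dots> \<le> ?f x / ?g x"
        using neg_ln_cdf_scaled_ge[OF \<alpha> _ _ pos] elim \<alpha> by (intro divide_right_mono) auto
      finally show ?case using elim by simp
    qed
  next
    fix a :: real assume a: "1 < a"
    \<comment> \<open>The midpoint of 1 and a leaves room on both sides: above 1/(2 \<alpha>) for
      \<open>cdf_lower_bound\<close>, below a for the strict conclusion.\<close>
    define c where "c = (1 + a) / 2 * (1 / (2 * \<alpha>))"
    have "1 / (2 * \<alpha>) < c" using a \<alpha> by (simp add: c_def field_simps)
    then have "\<forall>\<^sub>F x in at_right 0. exp (- c * (ln x)\<^sup>2) \<le> S.cdf x"
      by (rule S.cdf_lower_bound[OF jp \<alpha> K])
    then show "\<forall>\<^sub>F x in at_right 0. ?f x / ?g x < a"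
      using range
    proof eventually_elim
      case (elim x)
      then have g: "0 < ?g x" using \<alpha> by simp
      have "- c * (ln x)\<^sup>2 \<le> ln (S.cdf x)" using elim pos by (subst ln_ge_iff) auto
      then have "?f x \<le> (1 + a) / 2 * ?g x" by (simp add: c_def)
      also have "\<dots> < a * ?g x" using a g by (intro mult_strict_right_mono) auto
      finally show ?case using g by (simp only: pos_divide_less_eq)
    qed
  qed
  \<comment> \<open>Asymptotic equivalence counts 0/0 as 1; near 0 the denominator does not vanish,
    so the plain quotient is the same.\<close>
  then have "((\<lambda>x. if ?f x = 0 \<and> ?g x = 0 then 1 else ?f x / ?g x) \<longlongrightarrow> 1) (at_right 0)"
  proof (rule Lim_transform_eventually)
    show "\<forall>\<^sub>F x in at_right 0. ?f x / ?g x = (if ?f x = 0 \<and> ?g x = 0 then 1 else ?f x / ?g x)"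
      using range by eventually_elim (use \<alpha> in auto)
  qed
  then show ?thesis unfolding asymp_equiv_def .
qed

end

theorem theorem1p16:
  fixes M :: "'a measure"
  shows
    "(\<forall>(Y :: real \<Rightarrow> 'a \<Rightarrow> real) (\<pi> :: real measure).
        levy_process M Y \<and> is_levy_measure M Y \<pi> \<and>
        drifts_to_infinity M Y \<and> has_positive_jumps \<pi> \<longrightarrow>
          (\<exists>C>0. \<forall>\<^sub>F x in at_right (0::real).
             ennreal (cdf_exp_functional M Y x) \<ge> ennreal (C * x) * levy_tail \<pi> (ln (1 / x))) \<and>
          (\<forall>c::real. ereal c > 1 / (2 * sup_positive_jumps \<pi>) \<longrightarrow>
             (\<forall>\<^sub>F x in at_right (0::real).
                cdf_exp_functional M Y x \<ge> exp (- c * (ln x)\<^sup>2)))) \<and>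
     (\<forall>(N :: real \<Rightarrow> 'a \<Rightarrow> real) (p::real) (\<alpha>::real).
        poisson_process M N p \<and> \<alpha> > 0 \<longrightarrow>
          (\<lambda>x. - ln (cdf_exp_functional M (\<lambda>t \<omega>. \<alpha> * N t \<omega>) x))
            \<sim>[at_right 0] (\<lambda>x. 1 / (2 * \<alpha>) * (ln x)\<^sup>2))"
  using levy_process.cdf_ge_levy_tail levy_process.cdf_ge_exp_square
    poisson_process.neg_ln_cdf_scaled_asymp
  by blast

end
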